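(* Consider the state-space model $\dot{x}(t)=f(x(t),u(t))$, $y(t)=g(x(t),u(t))$ with inputs $u\in\mathcal{U}^+$ and initial conditions in $\mathcal{X}_0\subseteq\mathbb{R}^{n_x}$. Suppose that the model is globally $\delta$ISS and that its inputs are equibounded and Lipschitz-continuous (there exist $M,K>0$ such that $\|u(t)\|\le M$ and $\|u(t)-u(s)\|\le K|t-s|$ for all $u\in\mathcal{U}^+$ and all $t,s\ge0$). (i) Given $x_0\in\mathcal{X}_0$, for all $\varepsilon>0$ there exist $m\in\mathbb{N}$, a Hurwitz matrix $A\in\mathbb{R}^{m\times m}$, $B\in\mathbb{R}^{m\times n_u}$, $z_0\in\mathbb{R}^m$ and a smooth function $h$ such that for all $u\in\mathcal{U}^+$ and $t\ge0$, the output $y$ of the model associated with the initial condition $x(0)=x_0$ and the input $u$ satisfies $$\left\|y(t)-h\left(e^{At}z_0+\int_0^t e^{A(t-s)}Bu(s)\,ds,\;u(t)\right)\right\|<\varepsilon.$$ (ii) If, moreover, $\mathcal{X}_0$ is compact and the Realization Assumption (stated in the context) holds on $\mathcal{X}_0$, then the approximation applies to all initial conditions in $\mathcal{X}_0$ by adjusting $z_0$ accordingly: for all $\varepsilon>0$ there exist $m\in\mathbb{N}$, a Hurwitz matrix $A\in\mathbb{R}^{m\times m}$, $B\in\mathbb{R}^{m\times n_u}$ and a smooth function $h$ such that for every $x_0\in\mathcal{X}_0$ there exists $z_0\in\mathbb{R}^m$ for which, for all $u\in\mathcal{U}^+$ and $t\ge0$, the output $y$ of the model associated with the initial condition $x(0)=x_0$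 and the input $u$ satisfies $$\left\|y(t)-h\left(e^{At}z_0+\int_0^t e^{A(t-s)}Bu(s)\,ds,\;u(t)\right)\right\|<\varepsilon.$$
   Context: Setting: $x(t)\in\mathbb{R}^{n_x}$ is the state, $u\in\mathcal{U}^+\subset L_\infty([0,+\infty),\mathbb{R}^{n_u})$ the input, $y(t)\in\mathbb{R}^{n_y}$ the output. The system is assumed forward complete (for every considered initial condition and every $u\in\mathcal{U}^+$ the state trajectory is uniquely defined on $[0,+\infty)$), and $g$ is smooth in both arguments. Comparison functions: $\alpha:[0,+\infty)\to[0,+\infty)$ is of class $\mathcal{K}$ if it is continuous, strictly increasing and $\alpha(0)=0$; of class $\mathcal{K}_\infty$ if moreover $\lim_{r\to\infty}\alpha(r)=+\infty$. $\beta:[0,+\infty)^2\to[0,+\infty)$ is of class $\mathcal{KL}$ if it is continuous, $\beta(\cdot,s)\in\mathcal{K}$ for each $s$, and for each $r$, $\beta(r,\cdot)$ is nonincreasing with limit $0$ at $+\infty$. Globally $\delta$ISS: there exist $\beta\in\mathcal{KL}$ and $\gamma\in\mathcal{K}_\infty$ such that for any $x_a(0),x_b(0)\in\mathbb{R}^{n_x}$ and $u_a,u_b\in\mathcal{U}^+$, the state trajectories satisfy for all $t\ge0$: $\|x_a(t)-x_b(t)\|\le\beta(\|x_a(0)-x_b(0)\|,t)+\gamma(\operatorname{ess\,sup}_{s\in[0,t]}\|u_a(s)-u_b(s)\|)$. Memory kernel: a continuous nonincreasing function $w:[0,+\infty)\to[0,1]$ with $\lim_{\Delta t\to+\infty}w(\Delta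 t)=0$. State-space FM on $\mathcal{X}_0$: there exist $\beta\in\mathcal{KL}$, $\gamma\in\mathcal{K}_\infty$ and a memory kernel $w$ such that for any $x_a(0),x_b(0)\in\mathcal{X}_0$ and $u_a,u_b\in\mathcal{U}^+$, the outputs satisfy for all $t\ge0$: $\|y_a(t)-y_b(t)\|\le\beta(\|x_a(0)-x_b(0)\|,t)+\gamma(\operatorname{ess\,sup}_{s\in[0,t]}w(t-s)\|u_a(s)-u_b(s)\|)$. Operators: let $\mathcal{U}\subset L_\infty(\mathbb{R},\mathbb{R}^{n_u})$, $\mathcal{Y}\subset L_\infty(\mathbb{R},\mathbb{R}^{n_y})$; $\mathcal{U}^-$ and $\mathcal{U}^+$ are the sets of restrictions of elements of $\mathcal{U}$ to negative time $(-\infty,0]$ and positive time $[0,+\infty)$. Let $T_\tau f(t)=f(t-\tau)$. $G:\mathcal{U}\to\mathcal{Y}$ is time-invariant if $T_\tau u\in\mathcal{U}$ and $G(T_\tau u)=T_\tau G(u)$ for all $u\in\mathcal{U},\tau\in\mathbb{R}$; it is causal if for all $u_a,u_b\in\mathcal{U}$ and $t_0\in\mathbb{R}$, $u_a(t)=u_b(t)\ \forall t\le t_0$ implies $G(u_a)(t)=G(u_b)(t)\ \forall t\le t_0$. For $u_0\in\mathcal{U}^-$ and $u\in\mathcal{U}^+$, $u_0\diamond u$ denotes the temporal concatenation (equal to $u_0$ in negative time and to $u$ in positive time). A causal and time-invariant $G$ is an $(x_0,u_0)$-realization of the state-space model if $u_0\diamond u\in\mathcal{U}$ for all $u\in\mathcal{U}^+$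 and the output $y$ of the model with $x(0)=x_0$ and input $u\in\mathcal{U}^+$ satisfies $y(t)=G(u_0\diamond u)(t)$ for all $t\ge0$. Realization Assumption on $\mathcal{X}_0$: there exist a causal and time-invariant operator $G:\mathcal{U}\to\mathcal{Y}$ and a map $\psi:\mathcal{X}_0\to\mathcal{U}^-$ such that for all $x_0\in\mathcal{X}_0$, $G$ is an $(x_0,\psi(x_0))$-realization of the state-space model; moreover, with $\beta\in\mathcal{KL}$ the function in a state-space FM inequality satisfied by the model on $\mathcal{X}_0$, there exist $\tilde\gamma\in\mathcal{K}_\infty$ and a memory kernel $\tilde w$ such that for all $x_{0,a},x_{0,b}\in\mathcal{X}_0$ and $t\ge0$: $$\beta(\|x_{0,a}-x_{0,b}\|,t)\le\tilde\gamma\big(\operatorname{ess\,sup}_{s\le0}\tilde w(t-s)\|\psi(x_{0,a})(s)-\psi(x_{0,b})(s)\|\big).$$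
   Formalization: The input set U^+ is additionally assumed closed under forward time shifts (u in U^+, τ≥0 gives u(·+τ) in U^+); without it (i) fails, e.g. f=-ux+1, g=x, U^+={1/(2(t+1))}, whose output is unbounded. In (ii) this already follows from shift-invariance of U. *)

theory Defs
  imports
    "HOL-Probability.Essential_Supremum"
    "Jordan_Normal_Form.Char_Poly"
begin

section \<open>Comparison functions and memory kernels\<close>

definition class_K :: "(real \<Rightarrow> real) \<Rightarrow> bool" where
  "class_K \<alpha> \<longleftrightarrow> continuous_on {0..} \<alpha> \<and> strict_mono_on {0..} \<alpha> \<and> \<alpha> 0 = 0"

definition class_K_inf :: "(real \<Rightarrow> real) \<Rightarrow> bool" where
  "class_K_inf \<alpha> \<longleftrightarrow> class_K \<alpha> \<and> filterlim \<alpha> at_top at_top"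

definition class_KL :: "(real \<Rightarrow> real \<Rightarrow> real) \<Rightarrow> bool" where
  "class_KL \<beta> \<longleftrightarrow>
     continuous_on ({0..} \<times> {0..}) (\<lambda>(r, s). \<beta> r s) \<and>
     (\<forall>s\<ge>0. class_K (\<lambda>r. \<beta> r s)) \<and>
     (\<forall>r\<ge>0. antimono_on {0..} (\<beta> r) \<and> (\<beta> r \<longlongrightarrow> 0) at_top)"

definition memory_kernel :: "(real \<Rightarrow> real) \<Rightarrow> bool" where
  "memory_kernel w \<longleftrightarrow>
     continuous_on {0..} w \<and> antimono_on {0..} w \<and> w ` {0..} \<subseteq> {0..1} \<and> (w \<longlongrightarrow> 0) at_top"

section \<open>Essentially bounded signals\<close>

text \<open>Signals are functions rather than almost-everywhere classes, since they are evaluated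
  pointwise. A signal on a set of times \<open>S\<close> is a total function of which only the values
  on \<open>S\<close> matter.\<close>

definition L_inf :: "real set \<Rightarrow> (real \<Rightarrow> 'a::euclidean_space) set" where
  "L_inf S = {u. u \<in> borel_measurable (lebesgue_on S) \<and>
                 (\<exists>C. AE s in lebesgue_on S. norm (u s) \<le> C)}"

text \<open>Essential supremum over \<open>S\<close> of a nonnegative, essentially bounded function. On a null set
  the usual definition degenerates; the only null set that occurs below is \<open>{0..0}\<close>,
  where we take the plain supremum, i.e. the value at 0. With the value 0 instead, the
  fading memory inequality at time 0 would exclude every output map that depends on the input.\<close>

definition ess_sup :: "real set \<Rightarrow> (real \<Rightarrow> real) \<Rightarrow> real" where
  "ess_sup S \<phi> =
     (if negligible S then (SUP s\<in>S. \<phi> s)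
      else enn2real (esssup (lebesgue_on S) (\<lambda>s. ennreal (\<phi> s))))"

section \<open>Smooth functions of finitely many real variables\<close>

text \<open>A function of real variables indexed by \<open>I\<close> is given as a map \<open>F\<close> on all coordinate
  assignments \<open>p :: 'i \<Rightarrow> real\<close> that does not depend on the coordinates outside \<open>I\<close>. For finite
  \<open>I\<close>, continuity in the product topology is then the usual continuity on the Euclidean space.\<close>

primrec C_k :: "'i set \<Rightarrow> nat \<Rightarrow> (('i \<Rightarrow> real) \<Rightarrow> 'b::real_normed_vector) \<Rightarrow> bool" where
  "C_k I 0 F \<longleftrightarrow> continuous_on UNIV F"
| "C_k I (Suc k) F \<longleftrightarrow> continuous_on UNIV F \<and>
     (\<forall>i\<in>I. (\<forall>p. (\<lambda>s. F (p(i := s))) differentiable (at (p i))) \<and>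
            C_k I k (\<lambda>p. vector_derivative (\<lambda>s. F (p(i := s))) (at (p i))))"

definition C_infinity :: "'i set \<Rightarrow> (('i \<Rightarrow> real) \<Rightarrow> 'b::real_normed_vector) \<Rightarrow> bool" where
  "C_infinity I F \<longleftrightarrow> (\<forall>k. C_k I k F)"

definition smooth_output_map :: "(real^'x \<Rightarrow> real^'u \<Rightarrow> real^'y) \<Rightarrow> bool" where
  "smooth_output_map g \<longleftrightarrow>
     C_infinity (UNIV :: ('x + 'u) set) (\<lambda>p. g (\<chi> i. p (Inl i)) (\<chi> j. p (Inr j)))"

definition smooth_readout :: "nat \<Rightarrow> (real Matrix.vec \<Rightarrow> real^'u \<Rightarrow> real^'y) \<Rightarrow> bool" where
  "smooth_readout m h \<longleftrightarrow>
     C_infinity ({..<m} <+> (UNIV :: 'u set))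
       (\<lambda>p. h (Matrix.vec m (\<lambda>i. p (Inl i))) (\<chi> j. p (Inr j)))"

section \<open>State-space models\<close>

text \<open>Caratheodory solutions, the standard notion for inputs that are merely essentially bounded.\<close>

definition trajectory ::
  "(real^'x \<Rightarrow> real^'u \<Rightarrow> real^'x) \<Rightarrow> real^'x \<Rightarrow> (real \<Rightarrow> real^'u) \<Rightarrow> (real \<Rightarrow> real^'x) \<Rightarrow> bool" where
  "trajectory f x0 u x \<longleftrightarrow>
     (\<forall>t\<ge>0. (\<lambda>s. f (x s) (u s)) absolutely_integrable_on {0..t} \<and>
            x t = x0 + integral {0..t} (\<lambda>s. f (x s) (u s)))"

definition forward_complete ::
  "(real^'x \<Rightarrow> real^'u \<Rightarrow> real^'x) \<Rightarrow> (real \<Rightarrow> real^'u) set \<Rightarrow> bool" where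
  "forward_complete f Uplus \<longleftrightarrow>
     (\<forall>x0. \<forall>u\<in>Uplus. (\<exists>x. trajectory f x0 u x) \<and>
        (\<forall>x x'. trajectory f x0 u x \<longrightarrow> trajectory f x0 u x' \<longrightarrow> (\<forall>t\<ge>0. x t = x' t)))"

text \<open>Restarting at a later time the model driven by an admissible input gives an admissible
  input again; this holds for the restrictions to positive time of any shift-invariant
  class of two-sided inputs.\<close>

definition forward_shift_closed :: "(real \<Rightarrow> 'a) set \<Rightarrow> bool" where
  "forward_shift_closed Uplus \<longleftrightarrow>
     (\<forall>u\<in>Uplus. \<forall>\<tau>\<ge>0. \<exists>v\<in>Uplus. \<forall>t\<ge>0. v t = u (t + \<tau>))"

definition globally_delta_ISS ::
  "(real^'x \<Rightarrow> real^'u \<Rightarrow> real^'x) \<Rightarrow> (real \<Rightarrow> real^'u) set \<Rightarrow> bool" where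
  "globally_delta_ISS f Uplus \<longleftrightarrow>
     (\<exists>\<beta> \<gamma>. class_KL \<beta> \<and> class_K_inf \<gamma> \<and>
        (\<forall>xa0 xb0. \<forall>ua\<in>Uplus. \<forall>ub\<in>Uplus. \<forall>xa xb.
           trajectory f xa0 ua xa \<longrightarrow> trajectory f xb0 ub xb \<longrightarrow>
           (\<forall>t\<ge>0. norm (xa t - xb t)
              \<le> \<beta> (norm (xa0 - xb0)) t + \<gamma> (ess_sup {0..t} (\<lambda>s. norm (ua s - ub s))))))"

definition state_space_FM_inequality ::
  "(real \<Rightarrow> real \<Rightarrow> real) \<Rightarrow> (real \<Rightarrow> real) \<Rightarrow> (real \<Rightarrow> real) \<Rightarrow>
   (real^'x \<Rightarrow> real^'u \<Rightarrow> real^'x) \<Rightarrow> (real^'x \<Rightarrow> real^'u \<Rightarrow> real^'y) \<Rightarrow>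
   (real \<Rightarrow> real^'u) set \<Rightarrow> (real^'x) set \<Rightarrow> bool" where
  "state_space_FM_inequality \<beta> \<gamma> w f g Uplus X0 \<longleftrightarrow>
     class_KL \<beta> \<and> class_K_inf \<gamma> \<and> memory_kernel w \<and>
     (\<forall>xa0\<in>X0. \<forall>xb0\<in>X0. \<forall>ua\<in>Uplus. \<forall>ub\<in>Uplus. \<forall>xa xb.
        trajectory f xa0 ua xa \<longrightarrow> trajectory f xb0 ub xb \<longrightarrow>
        (\<forall>t\<ge>0. norm (g (xa t) (ua t) - g (xb t) (ub t))
           \<le> \<beta> (norm (xa0 - xb0)) t
             + \<gamma> (ess_sup {0..t} (\<lambda>s. w (t - s) * norm (ua s - ub s)))))"

section \<open>Operators and realizations\<close>

definition time_shift :: "real \<Rightarrow> (real \<Rightarrow> 'a) \<Rightarrow> real \<Rightarrow> 'a" where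
  "time_shift \<tau> u = (\<lambda>t. u (t - \<tau>))"

definition time_invariant ::
  "(real \<Rightarrow> 'a) set \<Rightarrow> ((real \<Rightarrow> 'a) \<Rightarrow> (real \<Rightarrow> 'b)) \<Rightarrow> bool" where
  "time_invariant U G \<longleftrightarrow>
     (\<forall>u\<in>U. \<forall>\<tau>. time_shift \<tau> u \<in> U \<and> G (time_shift \<tau> u) = time_shift \<tau> (G u))"

definition causal ::
  "(real \<Rightarrow> 'a) set \<Rightarrow> ((real \<Rightarrow> 'a) \<Rightarrow> (real \<Rightarrow> 'b)) \<Rightarrow> bool" where
  "causal U G \<longleftrightarrow>
     (\<forall>ua\<in>U. \<forall>ub\<in>U. \<forall>t0. (\<forall>t\<le>t0. ua t = ub t) \<longrightarrow> (\<forall>t\<le>t0. G ua t = G ub t))"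

definition negative_restrictions :: "(real \<Rightarrow> 'a) set \<Rightarrow> (real \<Rightarrow> 'a) set" where
  "negative_restrictions U = {v. \<exists>u\<in>U. \<forall>t\<le>0. v t = u t}"

definition positive_restrictions :: "(real \<Rightarrow> 'a) set \<Rightarrow> (real \<Rightarrow> 'a) set" where
  "positive_restrictions U = {v. \<exists>u\<in>U. \<forall>t\<ge>0. v t = u t}"

definition concatenation :: "(real \<Rightarrow> 'a) \<Rightarrow> (real \<Rightarrow> 'a) \<Rightarrow> real \<Rightarrow> 'a" where
  "concatenation u0 u = (\<lambda>t. if t < 0 then u0 t else u t)"

definition is_realization ::
  "(real \<Rightarrow> real^'u) set \<Rightarrow> ((real \<Rightarrow> real^'u) \<Rightarrow> (real \<Rightarrow> real^'y)) \<Rightarrow>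
   (real^'x \<Rightarrow> real^'u \<Rightarrow> real^'x) \<Rightarrow> (real^'x \<Rightarrow> real^'u \<Rightarrow> real^'y) \<Rightarrow>
   (real \<Rightarrow> real^'u) set \<Rightarrow> real^'x \<Rightarrow> (real \<Rightarrow> real^'u) \<Rightarrow> bool" where
  "is_realization U G f g Uplus x0 u0 \<longleftrightarrow>
     causal U G \<and> time_invariant U G \<and>
     (\<forall>u\<in>Uplus. concatenation u0 u \<in> U \<and>
        (\<forall>x. trajectory f x0 u x \<longrightarrow>
           (\<forall>t\<ge>0. g (x t) (u t) = G (concatenation u0 u) t)))"

definition realization_assumption ::
  "(real \<Rightarrow> real^'u) set \<Rightarrow> (real \<Rightarrow> real^'y) set \<Rightarrow>
   (real^'x \<Rightarrow> real^'u \<Rightarrow> real^'x) \<Rightarrow> (real^'x \<Rightarrow> real^'u \<Rightarrow> real^'y) \<Rightarrow>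
   (real \<Rightarrow> real^'u) set \<Rightarrow> (real^'x) set \<Rightarrow> bool" where
  "realization_assumption U Y f g Uplus X0 \<longleftrightarrow>
     (\<exists>G \<psi>. G \<in> U \<rightarrow> Y \<and> causal U G \<and> time_invariant U G \<and>
        \<psi> \<in> X0 \<rightarrow> negative_restrictions U \<and>
        (\<forall>x0\<in>X0. is_realization U G f g Uplus x0 (\<psi> x0)) \<and>
        (\<exists>\<beta> \<gamma> w. state_space_FM_inequality \<beta> \<gamma> w f g Uplus X0 \<and>
           (\<exists>\<gamma>' w'. class_K_inf \<gamma>' \<and> memory_kernel w' \<and>
              (\<forall>xa0\<in>X0. \<forall>xb0\<in>X0. \<forall>t\<ge>0.
                 \<beta> (norm (xa0 - xb0)) t
                   \<le> \<gamma>' (ess_sup {..0} (\<lambda>s. w' (t - s) * norm (\<psi> xa0 s - \<psi> xb0 s)))))))"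

section \<open>Stable linear time-invariant systems of variable dimension\<close>

definition hurwitz :: "real Matrix.mat \<Rightarrow> bool" where
  "hurwitz A \<longleftrightarrow> (\<forall>z. eigenvalue (map_mat complex_of_real A) z \<longrightarrow> Re z < 0)"

definition mat_exp :: "real Matrix.mat \<Rightarrow> real Matrix.mat" where
  "mat_exp A = Matrix.mat (dim_row A) (dim_row A)
     (\<lambda>(i, j). \<Sum>k. (A ^\<^sub>m k) $$ (i, j) / fact k)"

text \<open>An \<open>m\<close> by \<open>CARD('u)\<close> matrix is given by its rows \<open>B 0, \<dots>, B (m - 1)\<close>.\<close>

definition input_mult :: "nat \<Rightarrow> (nat \<Rightarrow> real^'u) \<Rightarrow> real^'u \<Rightarrow> real Matrix.vec" where
  "input_mult m B v = Matrix.vec m (\<lambda>i. inner (B i) v)"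

definition linear_state ::
  "nat \<Rightarrow> real Matrix.mat \<Rightarrow> (nat \<Rightarrow> real^'u) \<Rightarrow> real Matrix.vec \<Rightarrow> (real \<Rightarrow> real^'u) \<Rightarrow>
   real \<Rightarrow> real Matrix.vec" where
  "linear_state m A B z0 u t =
     mat_exp (t \<cdot>\<^sub>m A) *\<^sub>v z0 +
     Matrix.vec m (\<lambda>i. integral {0..t}
       (\<lambda>s. vec_index (mat_exp ((t - s) \<cdot>\<^sub>m A) *\<^sub>v input_mult m B (u s)) i))"

end

theory Submission
  imports Defs
begin

text \<open>
  By global \<open>\<delta>\<close>ISS all trajectories starting in a bounded set remain in a common bounded set, and the
  state at time \<open>t\<close> is determined, up to a small error, by the input on \<open>[t - T, t]\<close> if \<open>t\<close> is large,
  and by \<open>t\<close>, the initial state and the input on \<open>[0, t]\<close> otherwise. A diagonal linear system with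
  poles \<open>-1, \<dots>, -N\<close> records all of this: autonomous modes carry \<open>exp (- t)\<close> and \<open>exp (- t) x0\<close>,
  i.e. a clock and an initial state that fade out together, and the remaining modes carry the
  moments \<open>\<integral> exp (- k s) u(t - s) ds\<close> for \<open>k \<le> N\<close>. By Weierstrass, finitely many such moments
  determine local averages of the recent input, hence its values, because inputs are
  equi-Lipschitz. Thus the output is, up to a small error, determined by finitely many bounded
  features, and Stone--Weierstrass turns this into a polynomial readout. Since the initial value of
  the linear system encodes \<open>x0\<close> directly, one system serves all initial states in a bounded set.
\<close>

section \<open>Polynomial readouts\<close>

text \<open>The readout receives neither the time nor the initial state, and a Hurwitz system cannot
  store them forever. For \<open>t \<ge> T\<close> this does no harm, since \<delta>ISS has made the
  remote past irrelevant; for \<open>t < T\<close> the stored values have shrunk by at most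
  \<open>exp (- T)\<close>, so reading them back costs a fixed factor.

  Two obstacles shape the stability estimates. The function \<gamma> compares two runs with the same
  start but bounds neither of them, and \<beta> may grow arbitrarily fast in its first argument; the
  common bound therefore comes from a contraction over a fixed horizon, built from unit steps.
  Moreover, \<open>f\<close> is not assumed continuous, so that a trajectory stays near its start
  for a short time cannot be read off the differential equation; it is derived from \<delta>ISS and
  a finite net of reference runs.\<close>

lemma C_k_continuous: "C_k I k F \<Longrightarrow> continuous_on UNIV F"
  by (cases k) auto

lemma C_k_SucD: "C_k I (Suc k) F \<Longrightarrow> C_k I k F"
proof (induction k arbitrary: F)
  case 0
  then show ?case by simp
next
  case (Suc k)
  from Suc.prems have "continuous_on UNIV F"
    and "\<And>i p. i \<in> I \<Longrightarrow> (\<lambda>s. F (p(i := s))) differentiable (at (p i))"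
    and "\<And>i. i \<in> I \<Longrightarrow> C_k I (Suc k) (\<lambda>p. vector_derivative (\<lambda>s. F (p(i := s))) (at (p i)))"
    by (subst (asm) C_k.simps, blast)+
  then show ?case
    using Suc.IH by (subst C_k.simps) blast
qed

lemma C_k_const: "C_k I k (\<lambda>_. c)"
  by (induction k arbitrary: c) auto

lemma C_k_coord: "C_k I k (\<lambda>p. p i)"
proof (cases k)
  case 0
  then show ?thesis by simp
next
  case (Suc k')
  have eq: "(\<lambda>s. (p(j := s)) i) = (if j = i then (\<lambda>s. s) else (\<lambda>_. p i))" for p :: "'a \<Rightarrow> real" and j
    by auto
  have "C_k I k' (\<lambda>p. vector_derivative (\<lambda>s. (p(j := s)) i) (at (p j)))" for j :: 'a
    by (cases "j = i") (simp_all add: C_k_const)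
  moreover have "(\<lambda>s. (p(j := s)) i) differentiable (at (p j))" for p :: "'a \<Rightarrow> real" and j
    unfolding eq by (cases "j = i") simp_all
  ultimately show ?thesis
    unfolding Suc C_k.simps by simp
qed

lemma C_k_add: "C_k I k F \<Longrightarrow> C_k I k G \<Longrightarrow> C_k I k (\<lambda>p. F p + G p)"
proof (induction k arbitrary: F G)
  case 0
  then show ?case by (simp add: continuous_on_add)
next
  case (Suc k)
  have "C_k I k (\<lambda>p. vector_derivative (\<lambda>s. F (p(i := s)) + G (p(i := s))) (at (p i)))"
    if i: "i \<in> I" for i
  proof -
    have "(\<lambda>p. vector_derivative (\<lambda>s. F (p(i := s)) + G (p(i := s))) (at (p i))) =
       (\<lambda>p. vector_derivative (\<lambda>s. F (p(i := s))) (at (p i)) +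
            vector_derivative (\<lambda>s. G (p(i := s))) (at (p i)))"
      using Suc.prems i by (auto intro!: ext vector_derivative_add_at)
    then show ?thesis
      using Suc.prems i by (simp add: Suc.IH)
  qed
  then show ?case
    using Suc.prems by (auto intro!: continuous_on_add differentiable_add)
qed

text \<open>The product rule leaves an undifferentiated factor in each summand;
  \<open>C_k_SucD\<close> supplies it at the lower order that the induction hypothesis asks
  for.\<close>

lemma C_k_mult:
  fixes F G :: "('i \<Rightarrow> real) \<Rightarrow> real"
  shows "C_k I k F \<Longrightarrow> C_k I k G \<Longrightarrow> C_k I k (\<lambda>p. F p * G p)"
proof (induction k arbitrary: F G)
  case 0
  then show ?case by (simp add: continuous_on_mult)
next
  case (Suc k)
  have "C_k I k (\<lambda>p. vector_derivative (\<lambda>s. F (p(i := s)) * G (p(i := s))) (at (p i)))"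
    if i: "i \<in> I" for i
  proof -
    have "(\<lambda>p. vector_derivative (\<lambda>s. F (p(i := s)) * G (p(i := s))) (at (p i))) =
       (\<lambda>p. F p * vector_derivative (\<lambda>s. G (p(i := s))) (at (p i)) +
            vector_derivative (\<lambda>s. F (p(i := s))) (at (p i)) * G p)"
      using Suc.prems i by (auto intro!: ext)
    moreover have "C_k I k F" "C_k I k G"
      using Suc.prems by (auto intro: C_k_SucD simp del: C_k.simps)
    ultimately show ?thesis
      using Suc.prems i by (simp add: Suc.IH C_k_add)
  qed
  then show ?case
    using Suc.prems by (auto intro!: continuous_on_mult differentiable_mult)
qed

lemma C_k_scaleR_const:
  fixes F :: "('i \<Rightarrow> real) \<Rightarrow> real"
  shows "C_k I k F \<Longrightarrow> C_k I k (\<lambda>p. F p *\<^sub>R c)"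
proof (induction k arbitrary: F)
  case 0
  then show ?case by (simp add: continuous_on_scaleR)
next
  case (Suc k)
  have der: "((\<lambda>s. F (p(i := s)) *\<^sub>R c) has_vector_derivative
      vector_derivative (\<lambda>s. F (p(i := s))) (at (p i)) *\<^sub>R c) (at (p i))" if i: "i \<in> I" for i p
  proof -
    have "(\<lambda>s. F (p(i := s))) differentiable (at (p i))"
      using Suc.prems i by simp
    then have "((\<lambda>s. F (p(i := s))) has_vector_derivative
        vector_derivative (\<lambda>s. F (p(i := s))) (at (p i))) (at (p i))"
      by (simp add: vector_derivative_works)
    then show ?thesis
      by (auto intro!: derivative_eq_intros
          simp: has_real_derivative_iff_has_vector_derivative)
  qed
  have "C_k I k (\<lambda>p. vector_derivative (\<lambda>s. F (p(i := s)) *\<^sub>R c) (at (p i)))" if "i \<in> I" for i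
    using Suc.prems that by (simp add: vector_derivative_at[OF der] Suc.IH)
  moreover have "(\<lambda>s. F (p(i := s)) *\<^sub>R c) differentiable (at (p i))" if "i \<in> I" for i p
    using der[OF that] by (rule differentiableI_vector)
  ultimately show ?case
    using Suc.prems by (auto intro!: continuous_on_scaleR)
qed

lemma C_k_sum: "(\<And>a. a \<in> A \<Longrightarrow> C_k I k (F a)) \<Longrightarrow> C_k I k (\<lambda>p. \<Sum>a\<in>A. F a p)"
  by (induction A rule: infinite_finite_induct) (simp_all add: C_k_const C_k_add)

section \<open>Polynomials in selected coordinates and Stone-Weierstrass\<close>

inductive_set polynomial_functions :: "'i set \<Rightarrow> (('i \<Rightarrow> real) \<Rightarrow> real) set" for I where
  const: "(\<lambda>_. c) \<in> polynomial_functions I"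
| coord: "i \<in> I \<Longrightarrow> (\<lambda>p. p i) \<in> polynomial_functions I"
| add: "F \<in> polynomial_functions I \<Longrightarrow> G \<in> polynomial_functions I \<Longrightarrow>
    (\<lambda>p. F p + G p) \<in> polynomial_functions I"
| mult: "F \<in> polynomial_functions I \<Longrightarrow> G \<in> polynomial_functions I \<Longrightarrow>
    (\<lambda>p. F p * G p) \<in> polynomial_functions I"

lemma polynomial_functions_C_k: "F \<in> polynomial_functions I \<Longrightarrow> C_k J k F"
  by (induction rule: polynomial_functions.induct)
    (simp_all add: C_k_const C_k_coord C_k_add C_k_mult)

lemma polynomial_functions_cong:
  "F \<in> polynomial_functions I \<Longrightarrow> (\<And>i. i \<in> I \<Longrightarrow> p i = q i) \<Longrightarrow> F p = F q"
  by (induction rule: polynomial_functions.induct) auto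

text \<open>Tychonoff in the function space. The bound depends on the coordinate so that unwanted
  coordinates can be pinned to 0 by \<open>c i = 0\<close>.\<close>

lemma compact_box_fun:
  "compact {z :: 'i \<Rightarrow> real. \<forall>i. \<bar>z i\<bar> \<le> c i}"
proof -
  have "compactin (product_topology (\<lambda>i. euclidean) UNIV) (PiE UNIV (\<lambda>i. {- c i..c i}))"
    by (subst compactin_PiE) simp
  moreover have "PiE UNIV (\<lambda>i. {- c i..c i}) = {z. \<forall>i. \<bar>z i\<bar> \<le> c i}"
    by (auto simp: abs_le_iff PiE_iff minus_le_iff)
  ultimately show ?thesis
    by (simp add: euclidean_product_topology)
qed

text \<open>Pinning the coordinates outside \<open>I\<close> to 0 leaves a compact box whose points
  can differ only inside \<open>I\<close>, so the coordinate functions separate them. The other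
  rules of \<open>polynomial_functions\<close> are the closure conditions of
  \<open>function_ring_on\<close>.\<close>

lemma Stone_Weierstrass_finitely_many_coordinates:
  fixes F :: "('i::countable \<Rightarrow> real) \<Rightarrow> real"
  assumes "continuous_on UNIV F" "0 < \<epsilon>"
  obtains G where "G \<in> polynomial_functions I"
    and "\<And>z. (\<And>i. i \<in> I \<Longrightarrow> \<bar>z i\<bar> \<le> C) \<Longrightarrow> (\<And>i. i \<notin> I \<Longrightarrow> z i = 0) \<Longrightarrow> \<bar>F z - G z\<bar> < \<epsilon>"
proof -
  define S where "S = {z :: 'i \<Rightarrow> real. \<forall>i. \<bar>z i\<bar> \<le> (if i \<in> I then C else 0)}"
  interpret function_ring_on "polynomial_functions I" S
  proof
    show "compact S"
      unfolding S_def by (rule compact_box_fun)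
    show "continuous_on S G" if "G \<in> polynomial_functions I" for G
      using C_k_continuous[OF polynomial_functions_C_k[OF that]] continuous_on_subset by blast
    show "\<exists>G\<in>polynomial_functions I. G x \<noteq> G y" if "x \<in> S" "y \<in> S" "x \<noteq> y" for x y
    proof -
      obtain i where i: "x i \<noteq> y i"
        using \<open>x \<noteq> y\<close> by auto
      have "i \<in> I"
      proof (rule ccontr)
        assume "i \<notin> I"
        moreover have "\<bar>x i\<bar> \<le> (if i \<in> I then C else 0)" "\<bar>y i\<bar> \<le> (if i \<in> I then C else 0)"
          using that by (simp_all add: S_def)
        ultimately show False
          using i by simp
      qed
      then show ?thesis
        using i by (intro bexI[OF _ polynomial_functions.coord])
    qed
  qed (fact polynomial_functions.add polynomial_functions.mult polynomial_functions.const)+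
  obtain G where "G \<in> polynomial_functions I" "\<forall>z\<in>S. \<bar>F z - G z\<bar> < \<epsilon>"
    using Stone_Weierstrass_basic assms continuous_on_subset by blast
  then show ?thesis
    by (intro that[of G]) (auto simp: S_def)
qed

text \<open>A function that is only almost determined by its features is replaced by the Lipschitz
  function of the features given by an infimal convolution, to which Stone--Weierstrass applies.\<close>

lemma polynomial_approximation_via_features:
  fixes \<Phi> :: "'p \<Rightarrow> 'i::countable \<Rightarrow> real" and F :: "'p \<Rightarrow> real"
  assumes "finite I" and C: "\<And>p i. p \<in> P \<Longrightarrow> i \<in> I \<Longrightarrow> \<bar>\<Phi> p i\<bar> \<le> C"
    and D: "\<And>p. p \<in> P \<Longrightarrow> \<bar>F p\<bar> \<le> D" and "0 < \<delta>" "0 < \<epsilon>"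
    and sep: "\<And>p q. p \<in> P \<Longrightarrow> q \<in> P \<Longrightarrow> (\<And>i. i \<in> I \<Longrightarrow> \<bar>\<Phi> p i - \<Phi> q i\<bar> < \<delta>) \<Longrightarrow> \<bar>F p - F q\<bar> < \<epsilon>"
  obtains G where "G \<in> polynomial_functions I" and "\<And>p. p \<in> P \<Longrightarrow> \<bar>G (\<Phi> p) - F p\<bar> < 2 * \<epsilon>"
proof (cases "P = {}")
  case True
  then show ?thesis
    using that[OF polynomial_functions.const] by simp
next
  case False
  \<comment> \<open>With this slope, a point whose features differ from those of \<open>p\<close> by
    \<delta> in some coordinate pays at least \<open>2 * D\<close>, which dominates any difference
    of two values of \<open>F\<close>. Only \<delta>-near points can pull the infimum below
    \<open>F p\<close>, and those by less than \<epsilon>.\<close>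
  define L where "L = 2 * D / \<delta>"
  have "0 \<le> D"
    using False D by force
  then have "0 \<le> L"
    using \<open>0 < \<delta>\<close> by (simp add: L_def)
  define d where "d z z' = (\<Sum>i\<in>I. \<bar>z i - z' i\<bar>)" for z z' :: "'i \<Rightarrow> real"
  define E where "E z = (INF q\<in>P. F q + L * d z (\<Phi> q))" for z
  have d0: "0 \<le> d z z'" for z z'
    by (simp add: d_def sum_nonneg)
  have lower: "- D \<le> F q + L * d z (\<Phi> q)" if "q \<in> P" for q z
    using D[OF that] mult_nonneg_nonneg[OF \<open>0 \<le> L\<close> d0[of z "\<Phi> q"]] by linarith
  have bdd: "bdd_below ((\<lambda>q. F q + L * d z (\<Phi> q)) ` P)" for z
    using lower by (intro bdd_belowI2[of _ "- D"])
  have E_lip: "E z \<le> E z' + L * d z z'" for z z'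
  proof -
    have "E z - L * d z z' \<le> F q + L * d z' (\<Phi> q)" if "q \<in> P" for q
    proof -
      have "E z \<le> F q + L * d z (\<Phi> q)"
        unfolding E_def using bdd that by (rule cINF_lower)
      moreover have "d z (\<Phi> q) \<le> d z z' + d z' (\<Phi> q)"
        unfolding d_def sum.distrib[symmetric] by (rule sum_mono) linarith
      then have "L * d z (\<Phi> q) \<le> L * d z z' + L * d z' (\<Phi> q)"
        using \<open>0 \<le> L\<close> by (metis distrib_left mult_left_mono)
      ultimately show ?thesis by linarith
    qed
    then have "E z - L * d z z' \<le> E z'"
      unfolding E_def[of z'] using False by (intro cINF_greatest)
    then show ?thesis by simp
  qed
  have "continuous_on UNIV E"
    unfolding continuous_on_def
  proof
    fix z
    have "d z' z = d z z'" for z'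
      by (simp add: d_def abs_minus_commute)
    then have "norm (E z' - E z) \<le> L * d z' z" for z'
      using E_lip[of z z'] E_lip[of z' z] by (simp add: abs_le_iff)
    then have E_le: "\<forall>\<^sub>F z' in at z. norm (E z' - E z) \<le> L * d z' z"
      by (intro always_eventually allI)
    have "((\<lambda>z'. L * d z' z) \<longlongrightarrow> L * d z z) (at z)"
    proof -
      have "continuous_on UNIV (\<lambda>z'. L * d z' z)"
        unfolding d_def by (intro continuous_intros continuous_on_product_coordinates)
      then show ?thesis
        by (auto simp: continuous_on_def)
    qed
    then have "((\<lambda>z'. L * d z' z) \<longlongrightarrow> 0) (at z)"
      by (simp add: d_def)
    with E_le have "((\<lambda>z'. E z' - E z) \<longlongrightarrow> 0) (at z)"
      by (rule Lim_null_comparison)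
    then show "(E \<longlongrightarrow> E z) (at z within UNIV)"
      by (rule LIM_zero_cancel)
  qed
  from Stone_Weierstrass_finitely_many_coordinates[OF this \<open>0 < \<epsilon>\<close>, of I C]
  obtain G where G: "G \<in> polynomial_functions I"
    "\<And>z. (\<And>i. i \<in> I \<Longrightarrow> \<bar>z i\<bar> \<le> C) \<Longrightarrow> (\<And>i. i \<notin> I \<Longrightarrow> z i = 0) \<Longrightarrow> \<bar>E z - G z\<bar> < \<epsilon>"
    by blast
  \<comment> \<open>One \<epsilon> is lost to the infimal convolution, the other to
    Stone-Weierstrass.\<close>
  have "\<bar>G (\<Phi> p) - F p\<bar> < 2 * \<epsilon>" if p: "p \<in> P" for p
  proof -
    \<comment> \<open>\<open>\<Phi> p\<close> may be nonzero outside \<open>I\<close>; the truncated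
      copy lies in the box, and neither \<open>G\<close> nor \<open>d\<close> notices the
      change.\<close>
    define z where "z i = (if i \<in> I then \<Phi> p i else 0)" for i
    have dz: "d z z' = d (\<Phi> p) z'" for z'
      by (simp add: d_def z_def)
    have "G (\<Phi> p) = G z"
      by (rule polynomial_functions_cong[OF G(1)]) (simp add: z_def)
    moreover have "\<bar>E z - G z\<bar> < \<epsilon>"
      using C[OF p] by (intro G(2)) (auto simp: z_def)
    moreover have "E z \<le> F p + L * d z (\<Phi> p)"
      unfolding E_def using bdd p by (rule cINF_lower)
    then have "E z \<le> F p"
      by (simp add: dz) (simp add: d_def)
    moreover have "F p - \<epsilon> \<le> F q + L * d z (\<Phi> q)" if q: "q \<in> P" for q
    proof (cases "\<forall>i\<in>I. \<bar>\<Phi> p i - \<Phi> q i\<bar> < \<delta>")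
      case True
      then have "\<bar>F p - F q\<bar> < \<epsilon>"
        using sep p q by blast
      then show ?thesis
        using mult_nonneg_nonneg[OF \<open>0 \<le> L\<close> d0[of z "\<Phi> q"]] by linarith
    next
      case False
      then obtain i where "i \<in> I" "\<delta> \<le> \<bar>\<Phi> p i - \<Phi> q i\<bar>"
        by force
      then have "\<delta> \<le> d z (\<Phi> q)"
        unfolding dz unfolding d_def using \<open>finite I\<close>
        by (intro order_trans[OF _ member_le_sum[of i I "\<lambda>i. \<bar>\<Phi> p i - \<Phi> q i\<bar>"]]) auto
      then have "L * \<delta> \<le> L * d z (\<Phi> q)"
        using \<open>0 \<le> L\<close> by (rule mult_left_mono)
      moreover have "L * \<delta> = 2 * D"
        using \<open>0 < \<delta>\<close> by (simp add: L_def)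
      ultimately show ?thesis
        using D[OF p] D[OF q] \<open>0 < \<epsilon>\<close> by linarith
    qed
    then have "F p - \<epsilon> \<le> E z"
      unfolding E_def using False by (intro cINF_greatest) auto
    ultimately show ?thesis by linarith
  qed
  with G(1) show ?thesis
    by (rule that)
qed

text \<open>The output coordinates are approximated separately; \<open>CARD('y)\<close> comes from
  bounding the norm by the sum of absolute coordinates. Independence of the coordinates outside
  \<open>I\<close> is recorded because \<open>H\<close> is later evaluated at assignments that are
  arbitrary there.\<close>

lemma smooth_approximation_via_features:
  fixes \<Phi> :: "'p \<Rightarrow> 'i::countable \<Rightarrow> real" and F :: "'p \<Rightarrow> real^'y" and \<epsilon> :: real
  assumes "finite I" and "\<And>p i. p \<in> P \<Longrightarrow> i \<in> I \<Longrightarrow> \<bar>\<Phi> p i\<bar> \<le> C"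
    and D: "\<And>p. p \<in> P \<Longrightarrow> norm (F p) \<le> D" and "0 < \<delta>" "0 < \<epsilon>"
    and sep: "\<And>p q. p \<in> P \<Longrightarrow> q \<in> P \<Longrightarrow> (\<And>i. i \<in> I \<Longrightarrow> \<bar>\<Phi> p i - \<Phi> q i\<bar> < \<delta>) \<Longrightarrow> norm (F p - F q) < \<epsilon>"
  shows "\<exists>H. C_infinity J H \<and> (\<forall>p q. (\<forall>i\<in>I. p i = q i) \<longrightarrow> H p = H q) \<and>
    (\<forall>p\<in>P. norm (H (\<Phi> p) - F p) < 2 * real CARD('y) * \<epsilon>)"
proof -
  have "\<exists>G. G \<in> polynomial_functions I \<and> (\<forall>p\<in>P. \<bar>G (\<Phi> p) - vec_nth (F p) j\<bar> < 2 * \<epsilon>)" for j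
  proof -
    show ?thesis
    proof (rule polynomial_approximation_via_features[where F = "\<lambda>p. vec_nth (F p) j" and P = P
        and \<Phi> = \<Phi> and I = I and C = C and D = D and \<delta> = \<delta> and \<epsilon> = \<epsilon>])
      show "\<bar>vec_nth (F p) j\<bar> \<le> D" if "p \<in> P" for p
        using D[OF that] component_le_norm_cart order_trans by blast
      show "\<bar>vec_nth (F p) j - vec_nth (F q) j\<bar> < \<epsilon>"
        if "p \<in> P" "q \<in> P" "\<And>i. i \<in> I \<Longrightarrow> \<bar>\<Phi> p i - \<Phi> q i\<bar> < \<delta>" for p q
        using sep[OF that] component_le_norm_cart[of "F p - F q" j] by simp
    qed (use assms in auto)
  qed
  then obtain G where G: "\<And>j. G j \<in> polynomial_functions I"
    "\<And>j p. p \<in> P \<Longrightarrow> \<bar>G j (\<Phi> p) - vec_nth (F p) j\<bar> < 2 * \<epsilon>"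
    by metis
  define H where "H = (\<lambda>p. \<Sum>j\<in>UNIV. G j p *\<^sub>R axis j (1 :: real))"
  have H_nth: "vec_nth (H p) j = G j p" for p j
  proof -
    have "vec_nth (H p) j = (\<Sum>i\<in>UNIV. if i = j then G i p else 0)"
      unfolding H_def sum_component by (intro sum.cong) (auto simp: axis_def)
    then show ?thesis by simp
  qed
  show ?thesis
  proof (intro exI conjI allI impI ballI)
    show "C_infinity J H"
      unfolding C_infinity_def H_def
      by (intro allI C_k_sum C_k_scaleR_const polynomial_functions_C_k[OF G(1)])
    show "H p = H q" if "\<forall>i\<in>I. p i = q i" for p q
      unfolding H_def
      by (intro sum.cong refl arg_cong2[of _ _ _ _ scaleR] polynomial_functions_cong[OF G(1)] bspec[OF that])
    show "norm (H (\<Phi> p) - F p) < 2 * real CARD('y) * \<epsilon>" if "p \<in> P" for p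
    proof -
      have "norm (H (\<Phi> p) - F p) \<le> (\<Sum>j\<in>UNIV. \<bar>vec_nth (H (\<Phi> p) - F p) j\<bar>)"
        by (rule norm_le_l1_cart)
      also have "\<dots> < (\<Sum>j\<in>(UNIV :: 'y set). 2 * \<epsilon>)"
        using G(2)[OF that] by (intro sum_strict_mono) (auto simp: H_nth)
      also have "\<dots> = 2 * real CARD('y) * \<epsilon>"
        by simp
      finally show ?thesis .
    qed
  qed
qed

section \<open>Diagonal linear systems\<close>

definition diagonal_matrix :: "nat \<Rightarrow> (nat \<Rightarrow> real) \<Rightarrow> real Matrix.mat" where
  "diagonal_matrix m a = Matrix.mat m m (\<lambda>(i, j). if i = j then a i else 0)"

lemma diagonal_matrix_carrier: "diagonal_matrix m a \<in> carrier_mat m m"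
  by (simp add: diagonal_matrix_def)

lemma smult_diagonal_matrix: "c \<cdot>\<^sub>m diagonal_matrix m a = diagonal_matrix m (\<lambda>i. c * a i)"
  by (rule eq_matI) (auto simp: diagonal_matrix_def)

lemma diagonal_matrix_mult_vec_index:
  assumes "v \<in> carrier_vec m" "i < m"
  shows "vec_index (diagonal_matrix m a *\<^sub>v v) i = a i * vec_index v i"
proof -
  have "vec_index (diagonal_matrix m a *\<^sub>v v) i = (\<Sum>j = 0..<m. (if i = j then a i else 0) * vec_index v j)"
    using assms by (simp add: diagonal_matrix_def scalar_prod_def)
  also have "\<dots> = (\<Sum>j = 0..<m. if i = j then a i * vec_index v j else 0)"
    by (rule sum.cong) auto
  finally show ?thesis
    using assms by simp
qed

lemma diagonal_matrix_power: "diagonal_matrix m a ^\<^sub>m k = diagonal_matrix m (\<lambda>i. a i ^ k)"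
proof (induction k)
  case 0
  show ?case
    by (rule eq_matI) (auto simp: diagonal_matrix_def)
next
  case (Suc k)
  have "diagonal_matrix m (\<lambda>i. a i ^ k) * diagonal_matrix m a = diagonal_matrix m (\<lambda>i. a i ^ Suc k)"
  proof (rule eq_matI)
    fix i j assume "i < dim_row (diagonal_matrix m (\<lambda>i. a i ^ Suc k))"
      "j < dim_col (diagonal_matrix m (\<lambda>i. a i ^ Suc k))"
    then have ij: "i < m" "j < m"
      by (simp_all add: diagonal_matrix_def)
    have "(diagonal_matrix m (\<lambda>i. a i ^ k) * diagonal_matrix m a) $$ (i, j) =
        (\<Sum>l = 0..<m. (if i = l then a i ^ k else 0) * (if l = j then a l else 0))"
      using ij by (simp add: diagonal_matrix_def scalar_prod_def)
    also have "\<dots> = (\<Sum>l = 0..<m. if i = l then a i ^ k * (if l = j then a l else 0) else 0)"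
      by (rule sum.cong) auto
    also have "\<dots> = diagonal_matrix m (\<lambda>i. a i ^ Suc k) $$ (i, j)"
      using ij by (simp add: diagonal_matrix_def)
    finally show "(diagonal_matrix m (\<lambda>i. a i ^ k) * diagonal_matrix m a) $$ (i, j) =
        diagonal_matrix m (\<lambda>i. a i ^ Suc k) $$ (i, j)" .
  qed (simp_all add: diagonal_matrix_def)
  then show ?case
    by (simp add: Suc.IH)
qed

lemma mat_exp_diagonal_matrix: "mat_exp (diagonal_matrix m a) = diagonal_matrix m (\<lambda>i. exp (a i))"
proof (rule eq_matI)
  fix i j assume "i < dim_row (diagonal_matrix m (\<lambda>i. exp (a i)))"
    "j < dim_col (diagonal_matrix m (\<lambda>i. exp (a i)))"
  then have ij: "i < m" "j < m"
    by (simp_all add: diagonal_matrix_def)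
  then have "mat_exp (diagonal_matrix m a) $$ (i, j) =
      (\<Sum>k. (if i = j then a i ^ k else 0) / fact k)"
    by (simp add: mat_exp_def diagonal_matrix_power) (simp add: diagonal_matrix_def)
  also have "\<dots> = (if i = j then exp (a i) else 0)"
    by (simp add: exp_def divide_inverse mult.commute)
  finally show "mat_exp (diagonal_matrix m a) $$ (i, j) = diagonal_matrix m (\<lambda>i. exp (a i)) $$ (i, j)"
    using ij by (simp add: diagonal_matrix_def)
qed (simp_all add: mat_exp_def diagonal_matrix_def)

lemma hurwitz_diagonal_matrix:
  assumes "\<And>i. i < m \<Longrightarrow> a i < 0"
  shows "hurwitz (diagonal_matrix m a)"
  unfolding hurwitz_def
proof (intro allI impI)
  fix z assume "eigenvalue (map_mat complex_of_real (diagonal_matrix m a)) z"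
  then obtain v where v: "v \<in> carrier_vec m" "v \<noteq> 0\<^sub>v m"
    "map_mat complex_of_real (diagonal_matrix m a) *\<^sub>v v = z \<cdot>\<^sub>v v"
    by (auto simp: eigenvalue_def eigenvector_def diagonal_matrix_def)
  \<comment> \<open>In a row where the eigenvector does not vanish, the eigenvalue equation cancels
    to \<open>z = a i\<close>.\<close>
  then obtain i where i: "i < m" "vec_index v i \<noteq> 0"
    by (metis carrier_vecD eq_vecI index_zero_vec(1) index_zero_vec(2))
  have "z * vec_index v i = vec_index (map_mat complex_of_real (diagonal_matrix m a) *\<^sub>v v) i"
    using v i by simp
  also have "\<dots> = (\<Sum>j = 0..<m. (if i = j then complex_of_real (a i) else 0) * vec_index v j)"
    using v(1) i by (auto simp: diagonal_matrix_def scalar_prod_def intro!: sum.cong)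
  also have "\<dots> = (\<Sum>j = 0..<m. if i = j then complex_of_real (a i) * vec_index v j else 0)"
    by (rule sum.cong) auto
  also have "\<dots> = complex_of_real (a i) * vec_index v i"
    using i by simp
  finally have "z = complex_of_real (a i)"
    using i by simp
  then show "Re z < 0"
    using assms i by simp
qed

text \<open>A diagonal system decouples into scalar filters, so each feature can be produced by its
  own pole, input row and initial value.\<close>

lemma linear_state_diagonal_matrix:
  assumes "z0 \<in> carrier_vec m"
  shows "linear_state m (diagonal_matrix m a) B z0 u t =
    Matrix.vec m (\<lambda>i. exp (t * a i) * vec_index z0 i +
      integral {0..t} (\<lambda>s. exp ((t - s) * a i) * inner (B i) (u s)))"
proof (rule eq_vecI)
  fix i assume "i < dim_vec (Matrix.vec m (\<lambda>i. exp (t * a i) * vec_index z0 i +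
      integral {0..t} (\<lambda>s. exp ((t - s) * a i) * inner (B i) (u s))))"
  then have i: "i < m" by simp
  have "vec_index (mat_exp (r \<cdot>\<^sub>m diagonal_matrix m a) *\<^sub>v v) i = exp (r * a i) * vec_index v i"
    if "v \<in> carrier_vec m" for r v
    using that i by (simp add: smult_diagonal_matrix mat_exp_diagonal_matrix diagonal_matrix_mult_vec_index)
  then show "vec_index (linear_state m (diagonal_matrix m a) B z0 u t) i =
    vec_index (Matrix.vec m (\<lambda>i. exp (t * a i) * vec_index z0 i +
      integral {0..t} (\<lambda>s. exp ((t - s) * a i) * inner (B i) (u s)))) i"
    using assms i by (simp add: linear_state_def input_mult_def)
qed (simp add: linear_state_def)

section \<open>Exponential moments of a Lipschitz signal\<close>

text \<open>A truncated Laplace transform at the integer \<open>k\<close>. For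
  \<open>w s = u (t - s)\<close> it is the state at time \<open>t\<close> of a scalar filter with
  pole \<open>- k\<close> started at 0.\<close>

definition exp_moment :: "nat \<Rightarrow> real \<Rightarrow> (real \<Rightarrow> real) \<Rightarrow> real" where
  "exp_moment k t w = integral {0..t} (\<lambda>s. exp (- (real k * s)) * w s)"

text \<open>The bound is independent of \<open>t\<close>; it makes the moment estimates uniform over
  the infinite horizon.\<close>

lemma integral_exp_minus_le_1:
  assumes "0 \<le> t"
  shows "integral {0..t} (\<lambda>s::real. exp (- s)) \<le> 1"
proof -
  have "((\<lambda>s. exp (- s)) has_integral (- exp (- t) - - exp (- 0))) {0..t}"
    using assms by (intro fundamental_theorem_of_calculus)
      (auto intro!: derivative_eq_intros simp: has_real_derivative_iff_has_vector_derivative[symmetric])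
  then show ?thesis
    by (simp add: integral_unique)
qed

text \<open>Weierstrass in the variable \<open>x = exp (- s)\<close>. The additional factor
  \<open>exp (- s)\<close> in the kernel keeps the error bound independent of \<open>t\<close>, and
  it raises every exponent by one, so that only moments of index at least 1, i.e. those of stable
  filters, occur.\<close>

lemma exp_kernel_integral_approx:
  fixes w :: "real \<Rightarrow> real"
  assumes "continuous_on {0..1} q" and "0 < e" "0 \<le> M"
  shows "\<exists>n a. \<forall>t w. 0 \<le> t \<longrightarrow> continuous_on {0..t} w \<longrightarrow> (\<forall>s\<in>{0..t}. \<bar>w s\<bar> \<le> M) \<longrightarrow>
    \<bar>integral {0..t} (\<lambda>s. exp (- s) * q (exp (- s)) * w s) - (\<Sum>i\<le>n. a i * exp_moment (Suc i) t w)\<bar> \<le> e * M"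
proof -
  obtain p where p: "real_polynomial_function p" "\<And>x. x \<in> {0..1} \<Longrightarrow> \<bar>q x - p x\<bar> < e"
    using Stone_Weierstrass_real_polynomial_function[OF compact_Icc assms(1,2)] by blast
  then obtain a n where pa: "p = (\<lambda>x. \<Sum>i\<le>n. a i * x ^ i)"
    by (auto simp: real_polynomial_function_iff_sum)
  show ?thesis
  proof (intro exI allI impI)
    fix t :: real and w
    assume t: "0 \<le> t" and w: "continuous_on {0..t} w" and M: "\<forall>s\<in>{0..t}. \<bar>w s\<bar> \<le> M"
    have cq: "continuous_on {0..t} (\<lambda>s. q (exp (- s)))"
      by (rule continuous_on_compose2[OF assms(1)]) (auto intro!: continuous_intros)
    have cp: "continuous_on {0..t} (\<lambda>s. p (exp (- s)))"
      unfolding pa by (intro continuous_intros)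
    have "(\<Sum>i\<le>n. a i * exp_moment (Suc i) t w) =
        integral {0..t} (\<lambda>s. \<Sum>i\<le>n. a i * (exp (- (real (Suc i) * s)) * w s))"
      unfolding exp_moment_def using w
      by (subst integral_sum) (auto intro!: integrable_continuous_interval continuous_intros)
    also have "(\<lambda>s. \<Sum>i\<le>n. a i * (exp (- (real (Suc i) * s)) * w s)) =
        (\<lambda>s. exp (- s) * p (exp (- s)) * w s)"
    proof
      fix s
      have "exp (- (real (Suc i) * s)) = exp (- s) * exp (- s) ^ i" for i
        by (simp add: exp_of_nat_mult[symmetric] exp_add[symmetric] algebra_simps)
      then show "(\<Sum>i\<le>n. a i * (exp (- (real (Suc i) * s)) * w s)) = exp (- s) * p (exp (- s)) * w s"
        unfolding pa by (simp add: sum_distrib_left sum_distrib_right mult_ac)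
    qed
    finally have mom: "(\<Sum>i\<le>n. a i * exp_moment (Suc i) t w) =
        integral {0..t} (\<lambda>s. exp (- s) * p (exp (- s)) * w s)" .
    have "integral {0..t} (\<lambda>s. exp (- s) * q (exp (- s)) * w s) -
        (\<Sum>i\<le>n. a i * exp_moment (Suc i) t w) =
        integral {0..t} (\<lambda>s. exp (- s) * (q (exp (- s)) - p (exp (- s))) * w s)"
      unfolding mom using w cq cp
      by (subst integral_diff[symmetric])
        (auto intro!: integrable_continuous_interval continuous_intros simp: algebra_simps)
    also have "\<bar>\<dots>\<bar> \<le> integral {0..t} (\<lambda>s. exp (- s) * (e * M))"
      unfolding real_norm_def[symmetric]
    proof (rule integral_norm_bound_integral)
      fix s assume s: "s \<in> {0..t}"
      then have "\<bar>q (exp (- s)) - p (exp (- s))\<bar> * \<bar>w s\<bar> \<le> e * M"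
        using p(2)[of "exp (- s)"] M s \<open>0 < e\<close> by (intro mult_mono) auto
      then show "norm (exp (- s) * (q (exp (- s)) - p (exp (- s))) * w s) \<le> exp (- s) * (e * M)"
        by (simp add: abs_mult mult.assoc)
    qed (use w cq cp in \<open>auto intro!: integrable_continuous_interval continuous_intros\<close>)
    also have "\<dots> = integral {0..t} (\<lambda>s. exp (- s)) * (e * M)"
      by simp
    also have "\<dots> \<le> 1 * (e * M)"
      using \<open>0 < e\<close> \<open>0 \<le> M\<close> integral_exp_minus_le_1[OF t] by (intro mult_right_mono) auto
    finally show "\<bar>integral {0..t} (\<lambda>s. exp (- s) * q (exp (- s)) * w s) -
        (\<Sum>i\<le>n. a i * exp_moment (Suc i) t w)\<bar> \<le> e * M"
      by simp
  qed
qed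

text \<open>The difference of the two signals is tested against a bump supported in \<open>{c..d}\<close>, which is
  approximated by a polynomial in \<open>exp (- s)\<close>.\<close>

lemma exp_moments_determine_local_values:
  fixes c d M \<eta> :: real
  assumes "0 \<le> c" "c < d" "0 < \<eta>" "0 \<le> M"
  shows "\<exists>N \<delta>. 0 < \<delta> \<and> (\<forall>t t' w w' y. d \<le> t \<longrightarrow> d \<le> t' \<longrightarrow>
    continuous_on {0..t} w \<longrightarrow> continuous_on {0..t'} w' \<longrightarrow>
    (\<forall>s\<in>{0..t}. \<bar>w s\<bar> \<le> M) \<longrightarrow> (\<forall>s\<in>{0..t'}. \<bar>w' s\<bar> \<le> M) \<longrightarrow>
    (\<forall>k\<in>{1..N}. \<bar>exp_moment k t w - exp_moment k t' w'\<bar> \<le> \<delta>) \<longrightarrow>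
    (\<forall>s\<in>{c..d}. \<bar>w s - w' s - y\<bar> \<le> \<eta>) \<longrightarrow> \<bar>y\<bar> \<le> 2 * \<eta>)"
proof -
  \<comment> \<open>In the variable \<open>x = exp (- s)\<close> this is positive exactly for
    \<open>s\<close> strictly between \<open>c\<close> and \<open>d\<close>; \<kappa> is the bump in
    the form that \<open>exp_kernel_integral_approx\<close> requires.\<close>
  define q :: "real \<Rightarrow> real" where "q x = max 0 ((x - exp (- d)) * (exp (- c) - x))" for x
  define \<kappa> where "\<kappa> s = exp (- s) * q (exp (- s))" for s
  have q: "continuous_on A q" for A
    unfolding q_def by (intro continuous_intros)
  have \<kappa>: "continuous_on A \<kappa>" for A
    unfolding \<kappa>_def by (intro continuous_intros continuous_on_compose2[OF q[of UNIV]]) auto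
  have \<kappa>_nonneg: "0 \<le> \<kappa> s" for s
    by (simp add: \<kappa>_def q_def)
  have \<kappa>_0: "\<kappa> s = 0" if "s \<notin> {c..d}" for s
  proof -
    have "(exp (- s) - exp (- d)) * (exp (- c) - exp (- s)) \<le> 0"
      using that \<open>c < d\<close> by (auto simp: mult_le_0_iff not_le)
    then show ?thesis
      by (simp add: \<kappa>_def q_def)
  qed
  define J where "J = integral {c..d} \<kappa>"
  have "0 \<le> J"
    unfolding J_def using \<kappa> \<kappa>_nonneg by (intro integral_nonneg integrable_continuous_interval) auto
  moreover have "J \<noteq> 0"
  proof -
    have "0 < \<kappa> ((c + d) / 2)"
      using \<open>c < d\<close> by (simp add: \<kappa>_def q_def less_max_iff_disj zero_less_mult_iff)
    moreover have "(c + d) / 2 \<in> {c..d}"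
      using \<open>c < d\<close> by simp
    ultimately show ?thesis
      unfolding J_def using integral_eq_0_iff[OF \<kappa> \<open>c < d\<close>] \<kappa>_nonneg by fastforce
  qed
  ultimately have "0 < J" by simp
  \<comment> \<open>\<open>J\<close> is the mass of the bump. The choices of \<open>e\<close> and
    \<delta> let the polynomial error and the moment error contribute at most
    \<open>J * \<eta> / 2\<close> each; the deviation of \<open>w - w'\<close> from \<open>y\<close>
    contributes \<open>J * \<eta>\<close>. Division by \<open>J\<close> leaves
    \<open>2 * \<eta>\<close>.\<close>
  define e where "e = \<eta> * J / (4 * (M + 1))"
  have "0 < e"
    using assms \<open>0 < J\<close> by (simp add: e_def)
  obtain n a where na: "\<forall>t w. 0 \<le> t \<longrightarrow> continuous_on {0..t} w \<longrightarrow> (\<forall>s\<in>{0..t}. \<bar>w s\<bar> \<le> M) \<longrightarrow>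
    \<bar>integral {0..t} (\<lambda>s. exp (- s) * q (exp (- s)) * w s) - (\<Sum>i\<le>n. a i * exp_moment (Suc i) t w)\<bar> \<le> e * M"
    using exp_kernel_integral_approx[OF q \<open>0 < e\<close> \<open>0 \<le> M\<close>] by (elim exE)
  define A where "A = (\<Sum>i\<le>n. \<bar>a i\<bar>)"
  have "0 \<le> A"
    by (simp add: A_def sum_nonneg)
  define \<delta> where "\<delta> = \<eta> * J / (2 * (A + 1))"
  have "0 < \<delta>"
    using assms \<open>0 < J\<close> \<open>0 \<le> A\<close> by (simp add: \<delta>_def)
  have "\<bar>y\<bar> \<le> 2 * \<eta>"
    if t: "d \<le> t" "d \<le> t'" and w: "continuous_on {0..t} w" "continuous_on {0..t'} w'"
      and M: "\<forall>s\<in>{0..t}. \<bar>w s\<bar> \<le> M" "\<forall>s\<in>{0..t'}. \<bar>w' s\<bar> \<le> M"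
      and mom: "\<forall>k\<in>{1..Suc n}. \<bar>exp_moment k t w - exp_moment k t' w'\<bar> \<le> \<delta>"
      and y: "\<forall>s\<in>{c..d}. \<bar>w s - w' s - y\<bar> \<le> \<eta>" for t t' w w' y
  proof -
    \<comment> \<open>Since the bump vanishes off \<open>{c..d}\<close>, integrals over histories of
      different lengths reduce to the same interval.\<close>
    have restrict: "integral {0..r} (\<lambda>s. exp (- s) * q (exp (- s)) * v s) = integral {c..d} (\<lambda>s. \<kappa> s * v s)"
      if "d \<le> r" "continuous_on {0..r} v" for r v
    proof -
      have "continuous_on {c..d} v"
        using that assms by (auto intro: continuous_on_subset)
      then have "((\<lambda>s. \<kappa> s * v s) has_integral integral {c..d} (\<lambda>s. \<kappa> s * v s)) {c..d}"
        using \<kappa> by (intro integrable_integral integrable_continuous_interval continuous_intros)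
      then have "((\<lambda>s. \<kappa> s * v s) has_integral integral {c..d} (\<lambda>s. \<kappa> s * v s)) {0..r}"
        by (rule has_integral_on_superset) (use \<kappa>_0 that assms in auto)
      then show ?thesis
        by (simp add: \<kappa>_def integral_unique)
    qed
    have cw: "continuous_on {c..d} w" "continuous_on {c..d} w'"
      using t w assms by (auto intro: continuous_on_subset)
    have "\<bar>(\<Sum>i\<le>n. a i * exp_moment (Suc i) t w) - (\<Sum>i\<le>n. a i * exp_moment (Suc i) t' w')\<bar> =
        \<bar>\<Sum>i\<le>n. a i * (exp_moment (Suc i) t w - exp_moment (Suc i) t' w')\<bar>"
      by (simp add: sum_subtractf right_diff_distrib)
    also have "\<dots> \<le> (\<Sum>i\<le>n. \<bar>a i\<bar> * \<delta>)"
    proof (rule order_trans[OF sum_abs sum_mono])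
      fix i assume "i \<in> {..n}"
      then have "\<bar>exp_moment (Suc i) t w - exp_moment (Suc i) t' w'\<bar> \<le> \<delta>"
        using mom by auto
      then show "\<bar>a i * (exp_moment (Suc i) t w - exp_moment (Suc i) t' w')\<bar> \<le> \<bar>a i\<bar> * \<delta>"
        by (simp add: abs_mult mult_left_mono)
    qed
    also have "\<dots> = A * \<delta>"
      by (simp add: A_def sum_distrib_right)
    finally have "\<bar>(\<Sum>i\<le>n. a i * exp_moment (Suc i) t w) - (\<Sum>i\<le>n. a i * exp_moment (Suc i) t' w')\<bar> \<le> A * \<delta>" .
    moreover have "\<bar>integral {c..d} (\<lambda>s. \<kappa> s * w s) - (\<Sum>i\<le>n. a i * exp_moment (Suc i) t w)\<bar> \<le> e * M"
      using na[rule_format, of t w] t w M assms restrict[of t w] by simp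
    moreover have "\<bar>integral {c..d} (\<lambda>s. \<kappa> s * w' s) - (\<Sum>i\<le>n. a i * exp_moment (Suc i) t' w')\<bar> \<le> e * M"
      using na[rule_format, of t' w'] t w M assms restrict[of t' w'] by simp
    ultimately have "\<bar>integral {c..d} (\<lambda>s. \<kappa> s * w s) - integral {c..d} (\<lambda>s. \<kappa> s * w' s)\<bar> \<le> 2 * (e * M) + A * \<delta>"
      by linarith
    also have "integral {c..d} (\<lambda>s. \<kappa> s * w s) - integral {c..d} (\<lambda>s. \<kappa> s * w' s) =
        integral {c..d} (\<lambda>s. \<kappa> s * y + \<kappa> s * (w s - w' s - y))"
      using cw \<kappa> by (subst integral_diff[symmetric])
        (auto intro!: integrable_continuous_interval continuous_intros simp: algebra_simps)
    also have "\<dots> = J * y + integral {c..d} (\<lambda>s. \<kappa> s * (w s - w' s - y))"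
      using cw \<kappa> by (subst integral_add)
        (auto intro!: integrable_continuous_interval continuous_intros simp: J_def)
    finally have "\<bar>J * y\<bar> \<le> 2 * (e * M) + A * \<delta> + \<bar>integral {c..d} (\<lambda>s. \<kappa> s * (w s - w' s - y))\<bar>"
      by linarith
    moreover have "\<bar>integral {c..d} (\<lambda>s. \<kappa> s * (w s - w' s - y))\<bar> \<le> integral {c..d} (\<lambda>s. \<kappa> s * \<eta>)"
      unfolding real_norm_def[symmetric]
    proof (rule integral_norm_bound_integral)
      show "norm (\<kappa> s * (w s - w' s - y)) \<le> \<kappa> s * \<eta>" if "s \<in> {c..d}" for s
        using y that \<kappa>_nonneg[of s] by (simp add: abs_mult mult_left_mono)
    qed (use cw \<kappa> in \<open>auto intro!: integrable_continuous_interval continuous_intros\<close>)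
    moreover have "integral {c..d} (\<lambda>s. \<kappa> s * \<eta>) = J * \<eta>"
      by (simp add: J_def)
    moreover have "2 * (e * M) \<le> J * \<eta> / 2"
    proof -
      have "M / (M + 1) \<le> 1"
        using \<open>0 \<le> M\<close> by simp
      then have "J * \<eta> / 2 * (M / (M + 1)) \<le> J * \<eta> / 2 * 1"
        using \<open>0 < J\<close> \<open>0 < \<eta>\<close> by (intro mult_left_mono) auto
      moreover have "2 * (e * M) = J * \<eta> / 2 * (M / (M + 1))"
        using \<open>0 \<le> M\<close> by (simp add: e_def field_simps)
      ultimately show ?thesis by simp
    qed
    moreover have "A * \<delta> \<le> J * \<eta> / 2"
    proof -
      have "A / (A + 1) \<le> 1"
        using \<open>0 \<le> A\<close> by simp
      then have "J * \<eta> / 2 * (A / (A + 1)) \<le> J * \<eta> / 2 * 1"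
        using \<open>0 < J\<close> \<open>0 < \<eta>\<close> by (intro mult_left_mono) auto
      moreover have "A * \<delta> = J * \<eta> / 2 * (A / (A + 1))"
        using \<open>0 \<le> A\<close> by (simp add: \<delta>_def field_simps)
      ultimately show ?thesis by simp
    qed
    ultimately have "\<bar>J * y\<bar> \<le> J * \<eta> / 2 + J * \<eta> / 2 + J * \<eta>"
      by linarith
    then have "J * \<bar>y\<bar> \<le> J * (2 * \<eta>)"
      using \<open>0 < J\<close> by (simp add: abs_mult)
    then show ?thesis
      using \<open>0 < J\<close> by simp
  qed
  then show ?thesis
    using \<open>0 < \<delta>\<close> by blast
qed

text \<open>Time is cut into cells of length \<open>l\<close>. On a cell close to \<open>s\<close>,
  the difference of the two signals is within \<open>\<eta> / 3\<close> of its value at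
  \<open>s\<close>, so the preceding lemma bounds that value by \<open>2 * (\<eta> / 3)\<close>. The
  hypothesis on \<open>w 0 - w' 0\<close> covers histories shorter than one cell. Neither
  \<open>N\<close> nor \<delta> depends on \<open>t\<close> or \<open>t'\<close>.\<close>

lemma exp_moments_determine_Lipschitz_signal:
  fixes K M T \<eta> :: real
  assumes "0 \<le> K" "0 \<le> M" "0 \<le> T" "0 < \<eta>"
  obtains N \<delta> where "0 < \<delta>"
    and "\<And>t t' w w' s. \<lbrakk>t \<le> t'; K-lipschitz_on {0..t} w; K-lipschitz_on {0..t'} w';
      \<And>s. s \<in> {0..t} \<Longrightarrow> \<bar>w s\<bar> \<le> M; \<And>s. s \<in> {0..t'} \<Longrightarrow> \<bar>w' s\<bar> \<le> M;
      \<bar>w 0 - w' 0\<bar> \<le> \<delta>; \<And>k. k \<in> {1..N} \<Longrightarrow> \<bar>exp_moment k t w - exp_moment k t' w'\<bar> \<le> \<delta>;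
      0 \<le> s; s \<le> t; s \<le> T\<rbrakk> \<Longrightarrow> \<bar>w s - w' s\<bar> \<le> \<eta>"
proof -
  \<comment> \<open>\<open>w - w'\<close> has Lipschitz constant \<open>2 * K\<close> and is
    compared at distances up to \<open>2 * l\<close>, so it varies by at most
    \<open>4 * K * l\<close>.\<close>
  define l where "l = \<eta> / (12 * (K + 1))"
  have "0 < l"
    using assms by (simp add: l_def)
  have Kl: "4 * K * l \<le> \<eta> / 3"
  proof -
    have "\<eta> / 3 * (K / (K + 1)) \<le> \<eta> / 3 * 1"
      using assms by (intro mult_left_mono) auto
    moreover have "4 * K * l = \<eta> / 3 * (K / (K + 1))"
      using assms by (simp add: l_def field_simps)
    ultimately show ?thesis by simp
  qed
  have "0 < \<eta> / 3"
    using assms by simp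
  define Q where "Q i N \<delta> \<longleftrightarrow> (\<forall>t t' w w' y. real (Suc i) * l \<le> t \<longrightarrow> real (Suc i) * l \<le> t' \<longrightarrow>
    continuous_on {0..t} w \<longrightarrow> continuous_on {0..t'} w' \<longrightarrow>
    (\<forall>s\<in>{0..t}. \<bar>w s\<bar> \<le> M) \<longrightarrow> (\<forall>s\<in>{0..t'}. \<bar>w' s\<bar> \<le> M) \<longrightarrow>
    (\<forall>k\<in>{1..N}. \<bar>exp_moment k t w - exp_moment k t' w'\<bar> \<le> \<delta>) \<longrightarrow>
    (\<forall>s\<in>{real i * l..real (Suc i) * l}. \<bar>w s - w' s - y\<bar> \<le> \<eta> / 3) \<longrightarrow> \<bar>y\<bar> \<le> 2 * (\<eta> / 3))"
    for i N :: nat and \<delta> :: real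
  have "\<exists>N \<delta>. 0 < \<delta> \<and> Q i N \<delta>" for i
    unfolding Q_def using \<open>0 < l\<close> \<open>0 < \<eta> / 3\<close> \<open>0 \<le> M\<close>
    by (intro exp_moments_determine_local_values) auto
  then obtain Ni \<delta>i where \<delta>i: "\<And>i. 0 < \<delta>i i" and Q: "\<And>i. Q i (Ni i) (\<delta>i i)"
    by metis
  obtain n :: nat where n: "T / l < real n"
    using reals_Archimedean2 by blast
  define N where "N = Max (Ni ` {..n})"
  define \<delta> where "\<delta> = Min (insert (\<eta> / 3) (\<delta>i ` {..n}))"
  have "0 < \<delta>"
    unfolding \<delta>_def using \<delta>i \<open>0 < \<eta> / 3\<close> by (subst Min_gr_iff) auto
  have "\<delta> \<le> \<eta> / 3"
    unfolding \<delta>_def by (rule Min_le) auto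
  have le: "Ni i \<le> N" "\<delta> \<le> \<delta>i i" if "i \<le> n" for i
    unfolding N_def \<delta>_def using that by (auto intro!: Max_ge Min_le simp del: Min_insert)
  show ?thesis
  proof (rule that[OF \<open>0 < \<delta>\<close>])
    fix t t' s :: real and w w' :: "real \<Rightarrow> real"
    assume t: "t \<le> t'" and lip: "K-lipschitz_on {0..t} w" "K-lipschitz_on {0..t'} w'"
      and M: "\<And>s. s \<in> {0..t} \<Longrightarrow> \<bar>w s\<bar> \<le> M" "\<And>s. s \<in> {0..t'} \<Longrightarrow> \<bar>w' s\<bar> \<le> M"
      and d0: "\<bar>w 0 - w' 0\<bar> \<le> \<delta>"
      and mom: "\<And>k. k \<in> {1..N} \<Longrightarrow> \<bar>exp_moment k t w - exp_moment k t' w'\<bar> \<le> \<delta>"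
      and s: "0 \<le> s" "s \<le> t" "s \<le> T"
    have D: "\<bar>(w r - w' r) - (w s - w' s)\<bar> \<le> \<eta> / 3" if "0 \<le> r" "r \<le> t" "\<bar>r - s\<bar> \<le> 2 * l" for r
    proof -
      have "\<bar>w r - w s\<bar> \<le> K * \<bar>r - s\<bar>" "\<bar>w' r - w' s\<bar> \<le> K * \<bar>r - s\<bar>"
        using lipschitz_onD[OF lip(1), of r s] lipschitz_onD[OF lip(2), of r s] that s t
        by (auto simp: dist_real_def)
      moreover have "K * \<bar>r - s\<bar> \<le> K * (2 * l)"
        using that assms by (intro mult_left_mono) auto
      then have "K * \<bar>r - s\<bar> \<le> \<eta> / 6"
        using Kl by simp
      ultimately show ?thesis by linarith
    qed
    show "\<bar>w s - w' s\<bar> \<le> \<eta>"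
    proof (cases "t < l")
      case True
      then have "\<bar>(w 0 - w' 0) - (w s - w' s)\<bar> \<le> \<eta> / 3"
        using s by (intro D) auto
      then show ?thesis
        using d0 \<open>\<delta> \<le> \<eta> / 3\<close> \<open>0 < \<eta>\<close> by linarith
    next
      case False
      define j where "j = nat \<lfloor>s / l\<rfloor>"
      have "real j = of_int \<lfloor>s / l\<rfloor>"
        using s \<open>0 < l\<close> by (simp add: j_def)
      then have "real j \<le> s / l" "s / l < real j + 1"
        by linarith+
      then have j: "real j * l \<le> s" "s < real (Suc j) * l"
        using \<open>0 < l\<close> by (simp_all add: field_simps)
      have "s / l \<le> T / l"
        using s \<open>0 < l\<close> by (simp add: divide_right_mono)
      then have "j \<le> n"
        using \<open>real j \<le> s / l\<close> n by linarith
      \<comment> \<open>The cell containing \<open>s\<close> may reach beyond \<open>t\<close>,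
        where \<open>w\<close> is not controlled. Then the previous cell is used; it ends before
        \<open>s\<close> and still lies within \<open>2 * l\<close> of it. It exists because
        \<open>l \<le> t\<close>.\<close>
      obtain i where i: "i \<le> n" "real (Suc i) * l \<le> t" "s - 2 * l \<le> real i * l"
        "real (Suc i) * l \<le> s + 2 * l"
      proof (cases "real (Suc j) * l \<le> t")
        case True
        show ?thesis
          using that[of j] \<open>j \<le> n\<close> True j \<open>0 < l\<close> by (simp add: algebra_simps)
      next
        case False
        with \<open>\<not> t < l\<close> obtain i where "j = Suc i"
          by (cases j) auto
        then show ?thesis
          using that[of i] \<open>j \<le> n\<close> j s \<open>0 < l\<close> by (simp add: algebra_simps)
      qed
      have "\<bar>w s - w' s\<bar> \<le> 2 * (\<eta> / 3)"
      proof (rule Q[of i, unfolded Q_def, rule_format, OF i(2)])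
        show "real (Suc i) * l \<le> t'"
          using i t by linarith
        show "continuous_on {0..t} w" "continuous_on {0..t'} w'"
          using lip by (auto intro: lipschitz_on_continuous_on)
        show "\<bar>exp_moment k t w - exp_moment k t' w'\<bar> \<le> \<delta>i i" if "k \<in> {1..Ni i}" for k
          using mom[of k] le[OF i(1)] that by simp
        show "\<bar>w r - w' r - (w s - w' s)\<bar> \<le> \<eta> / 3"
          if r: "r \<in> {real i * l..real (Suc i) * l}" for r
        proof -
          have "0 \<le> real i * l"
            using \<open>0 < l\<close> by simp
          moreover have "real i * l \<le> r" "r \<le> real (Suc i) * l"
            using r by auto
          ultimately have "0 \<le> r" "r \<le> t" "\<bar>r - s\<bar> \<le> 2 * l"
            using i by linarith+
          then show ?thesis
            by (rule D)
        qed
      qed (use M in auto)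
      then show ?thesis
        using \<open>0 < \<eta>\<close> by linarith
    qed
  qed
qed

lemma exp_moment_bound:
  assumes "1 \<le> k" "0 \<le> t" "continuous_on {0..t} w" "\<And>s. s \<in> {0..t} \<Longrightarrow> \<bar>w s\<bar> \<le> M"
  shows "\<bar>exp_moment k t w\<bar> \<le> M"
proof -
  have "0 \<le> M"
    using assms(4)[of 0] assms(2) by simp
  have "\<bar>exp_moment k t w\<bar> \<le> integral {0..t} (\<lambda>s. exp (- s) * M)"
    unfolding exp_moment_def real_norm_def[symmetric]
  proof (rule integral_norm_bound_integral)
    fix s assume s: "s \<in> {0..t}"
    then have "exp (- (real k * s)) \<le> exp (- s)"
      using assms(1) mult_right_mono[of 1 "real k" s] by simp
    then show "norm (exp (- (real k * s)) * w s) \<le> exp (- s) * M"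
      using assms(4)[OF s] by (simp add: abs_mult mult_mono)
  qed (use assms in \<open>auto intro!: integrable_continuous_interval continuous_intros\<close>)
  also have "\<dots> = integral {0..t} (\<lambda>s. exp (- s)) * M"
    by simp
  also have "\<dots> \<le> 1 * M"
    using integral_exp_minus_le_1[OF assms(2)] \<open>0 \<le> M\<close> by (rule mult_right_mono)
  finally show ?thesis by simp
qed

lemma integral_Icc_reflect:
  fixes h :: "real \<Rightarrow> real"
  shows "integral {0..t} (\<lambda>s. h (t - s)) = integral {0..t} h"
  using integral_shift_real_ivl[of "- t" "- t" 0 "\<lambda>x. h (- x)"]
    Henstock_Kurzweil_Integration.integral_reflect_real[where a = 0 and b = t and f = h]
  by simp

section \<open>Trajectories of incrementally stable models\<close>

lemma norm_diff_le_if_components: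
  fixes a b :: "real^'n"
  assumes "\<And>i. \<bar>vec_nth a i - vec_nth b i\<bar> \<le> \<delta>"
  shows "norm (a - b) \<le> real CARD('n) * \<delta>"
proof -
  have "norm (a - b) \<le> (\<Sum>i\<in>UNIV. \<bar>vec_nth (a - b) i\<bar>)"
    by (rule norm_le_l1_cart)
  also have "\<dots> \<le> (\<Sum>i\<in>(UNIV :: 'n set). \<delta>)"
    using assms by (intro sum_mono) auto
  finally show ?thesis by simp
qed

text \<open>Smoothness speaks of coordinate assignments with the product topology; the continuous
  coordinate map \<open>c\<close> carries its order-zero part back to pairs of vectors.\<close>

lemma smooth_output_map_continuous:
  assumes "smooth_output_map g"
  shows "continuous_on UNIV (\<lambda>(a, b). g a b)"
proof -
  have "C_k UNIV 0 (\<lambda>p. g (\<chi> i. p (Inl i)) (\<chi> j. p (Inr j)))"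
    using assms unfolding smooth_output_map_def C_infinity_def by blast
  then have g: "continuous_on UNIV (\<lambda>p. g (\<chi> i. p (Inl i)) (\<chi> j. p (Inr j)))"
    by simp
  define c :: "(real^'a) \<times> (real^'b) \<Rightarrow> 'a + 'b \<Rightarrow> real"
    where "c z k = (case k of Inl i \<Rightarrow> vec_nth (fst z) i | Inr j \<Rightarrow> vec_nth (snd z) j)" for z k
  have "continuous_on UNIV (\<lambda>z. c z k)" for k
    by (cases k) (auto simp: c_def intro!: continuous_intros)
  then have "continuous_on UNIV c"
    by (rule continuous_on_coordinatewise_then_product)
  then have "continuous_on UNIV (\<lambda>z. g (\<chi> i. c z (Inl i)) (\<chi> j. c z (Inr j)))"
    by (rule continuous_on_compose2[OF g]) simp
  then show ?thesis
    by (simp add: c_def case_prod_unfold)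
qed

text \<open>At \<open>t = 0\<close> the interval is null and \<open>ess_sup\<close> is the plain
  supremum; otherwise it is the measure-theoretic one, for which continuity provides measurability.
  The same bounds hold in both branches.\<close>

lemma ess_sup_Icc_bounds:
  assumes "0 \<le> t" "continuous_on {0..t} \<phi>"
    and \<phi>: "\<And>s. s \<in> {0..t} \<Longrightarrow> 0 \<le> \<phi> s" "\<And>s. s \<in> {0..t} \<Longrightarrow> \<phi> s \<le> C"
  shows "0 \<le> ess_sup {0..t} \<phi>" "ess_sup {0..t} \<phi> \<le> C"
proof -
  have "0 \<le> C"
    using \<phi>[of 0] \<open>0 \<le> t\<close> by simp
  have "bdd_above (\<phi> ` {0..t})"
    using \<phi>(2) by (intro bdd_aboveI2)
  then have "0 \<le> (SUP s\<in>{0..t}. \<phi> s)"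
    using \<phi>(1) \<open>0 \<le> t\<close> by (intro cSUP_upper2[where x = 0]) auto
  then show "0 \<le> ess_sup {0..t} \<phi>"
    by (simp add: ess_sup_def)
  have "(SUP s\<in>{0..t}. \<phi> s) \<le> C"
    using \<phi>(2) \<open>0 \<le> t\<close> by (intro cSUP_least) auto
  moreover have "esssup (lebesgue_on {0..t}) (\<lambda>s. ennreal (\<phi> s)) \<le> ennreal C"
  proof (rule esssup_I)
    have "\<phi> \<in> borel_measurable (lebesgue_on {0..t})"
      using assms(2) by (intro continuous_imp_measurable_on_sets_lebesgue) auto
    then show "(\<lambda>s. ennreal (\<phi> s)) \<in> borel_measurable (lebesgue_on {0..t})"
      by measurable
    show "AE s in lebesgue_on {0..t}. ennreal (\<phi> s) \<le> ennreal C"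
      using \<phi>(2) by (intro AE_I2) (simp add: ennreal_leI)
  qed
  then have "enn2real (esssup (lebesgue_on {0..t}) (\<lambda>s. ennreal (\<phi> s))) \<le> C"
    using \<open>0 \<le> C\<close> by (simp add: enn2real_leI)
  ultimately show "ess_sup {0..t} \<phi> \<le> C"
    by (simp add: ess_sup_def)
qed

lemma class_K_mono: "class_K \<alpha> \<Longrightarrow> 0 \<le> r \<Longrightarrow> r \<le> r' \<Longrightarrow> \<alpha> r \<le> \<alpha> r'"
  unfolding class_K_def using strict_mono_on_leD[of "{0..}" \<alpha> r r'] by simp

lemma class_K_nonneg: "class_K \<alpha> \<Longrightarrow> 0 \<le> r \<Longrightarrow> 0 \<le> \<alpha> r"
  using class_K_mono[of \<alpha> 0 r] by (simp add: class_K_def)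

lemma class_K_small:
  assumes "class_K \<alpha>" "0 < \<eta>"
  obtains \<delta> where "0 < \<delta>" "\<And>r. 0 \<le> r \<Longrightarrow> r \<le> \<delta> \<Longrightarrow> \<alpha> r < \<eta>"
proof -
  have "continuous_on {0..} \<alpha>" "\<alpha> 0 = 0"
    using assms by (simp_all add: class_K_def)
  then obtain d where d: "0 < d" "\<And>r. r \<in> {0..} \<Longrightarrow> dist r 0 < d \<Longrightarrow> dist (\<alpha> r) (\<alpha> 0) < \<eta>"
    using \<open>0 < \<eta>\<close> unfolding continuous_on_iff by (metis atLeast_iff order_refl)
  show ?thesis
  proof (rule that[of "d / 2"])
    show "\<alpha> r < \<eta>" if "0 \<le> r" "r \<le> d / 2" for r
      using d(2)[of r] that d(1) \<open>\<alpha> 0 = 0\<close> by (simp add: dist_real_def)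
  qed (use d in simp)
qed

section \<open>Continuity and restarting of trajectories\<close>

lemma trajectory_0: "trajectory f x0 u x \<Longrightarrow> x 0 = x0"
  by (simp add: trajectory_def)

lemma trajectory_continuous_on:
  assumes "trajectory f x0 u x"
  shows "continuous_on {0..t} x"
proof (cases "0 \<le> t")
  case True
  then have "(\<lambda>s. f (x s) (u s)) integrable_on {0..t}"
    using assms by (auto simp: trajectory_def absolutely_integrable_on_def)
  then have "continuous_on {0..t} (\<lambda>t. x0 + integral {0..t} (\<lambda>s. f (x s) (u s)))"
    by (intro continuous_intros indefinite_integral_continuous_1)
  then show ?thesis
    by (rule continuous_on_eq) (use assms in \<open>simp add: trajectory_def\<close>)
qed simp

lemma trajectory_shift:
  assumes traj: "trajectory f x0 u x" and "0 \<le> \<tau>" and v: "\<And>t. 0 \<le> t \<Longrightarrow> v t = u (t + \<tau>)"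
  shows "trajectory f (x \<tau>) v (\<lambda>t. x (t + \<tau>))"
  unfolding trajectory_def
proof (intro allI impI conjI)
  fix t :: real assume t: "0 \<le> t"
  define F where "F s = f (x s) (u s)" for s
  have F: "F absolutely_integrable_on {0..t + \<tau>}" "x (t + \<tau>) = x0 + integral {0..t + \<tau>} F"
    "x \<tau> = x0 + integral {0..\<tau>} F"
    using traj t \<open>0 \<le> \<tau>\<close> by (auto simp: trajectory_def F_def[abs_def])
  have "F absolutely_integrable_on {\<tau>..t + \<tau>}"
    using F(1) by (rule absolutely_integrable_on_subinterval) (use \<open>0 \<le> \<tau>\<close> in auto)
  then have "(\<lambda>s. F (s + \<tau>)) absolutely_integrable_on {0..t}"
    using integrable_shift_real_ivl_iff[of F \<tau> \<tau> "t + \<tau>"]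
      integrable_shift_real_ivl_iff[of "\<lambda>s. norm (F s)" \<tau> \<tau> "t + \<tau>"]
    by (simp add: absolutely_integrable_on_def)
  \<comment> \<open>The exceptional set is empty: the integrands agree on all of
    \<open>{0..t}\<close>.\<close>
  then show "(\<lambda>s. f (x (s + \<tau>)) (v s)) absolutely_integrable_on {0..t}"
    by (rule absolutely_integrable_spike[OF _ negligible_empty]) (simp add: v F_def)
  have "integral {0..t} (\<lambda>s. f (x (s + \<tau>)) (v s)) = integral {0..t} (\<lambda>s. F (s + \<tau>))"
    by (intro integral_cong) (simp add: v F_def)
  also have "\<dots> = integral {\<tau>..t + \<tau>} F"
    using integral_shift_real_ivl[of \<tau> \<tau> "t + \<tau>" F] by simp
  finally show "x (t + \<tau>) = x \<tau> + integral {0..t} (\<lambda>s. f (x (s + \<tau>)) (v s))"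
    using F t \<open>0 \<le> \<tau>\<close> Henstock_Kurzweil_Integration.integral_combine[of 0 \<tau> "t + \<tau>" F]
    by (simp add: absolutely_integrable_on_def)
qed

section \<open>Incrementally stable models with equibounded, equi-Lipschitz inputs\<close>

locale delta_ISS_model =
  fixes f :: "real^'x \<Rightarrow> real^'u \<Rightarrow> real^'x" and Uplus :: "(real \<Rightarrow> real^'u) set"
    and \<beta> :: "real \<Rightarrow> real \<Rightarrow> real" and \<gamma> :: "real \<Rightarrow> real" and M K :: real
  assumes shift: "forward_shift_closed Uplus"
    and complete: "forward_complete f Uplus"
    and \<beta>: "class_KL \<beta>" and \<gamma>: "class_K_inf \<gamma>"
    and delta_ISS: "\<lbrakk>ua \<in> Uplus; ub \<in> Uplus; trajectory f xa0 ua xa; trajectory f xb0 ub xb; 0 \<le> t\<rbrakk> \<Longrightarrow>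
      norm (xa t - xb t) \<le> \<beta> (norm (xa0 - xb0)) t + \<gamma> (ess_sup {0..t} (\<lambda>s. norm (ua s - ub s)))"
    and M_pos: "0 < M" and K_pos: "0 < K"
    and input_bound: "u \<in> Uplus \<Longrightarrow> 0 \<le> t \<Longrightarrow> norm (u t) \<le> M"
    and input_Lipschitz: "\<lbrakk>u \<in> Uplus; 0 \<le> t; 0 \<le> s\<rbrakk> \<Longrightarrow> norm (u t - u s) \<le> K * \<bar>t - s\<bar>"
begin

definition run :: "real^'x \<Rightarrow> (real \<Rightarrow> real^'u) \<Rightarrow> (real \<Rightarrow> real^'x) \<Rightarrow> bool" where
  "run x0 u x \<longleftrightarrow> u \<in> Uplus \<and> trajectory f x0 u x"

lemma \<gamma>_K: "class_K \<gamma>"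
  using \<gamma> by (simp add: class_K_inf_def)

lemma \<beta>_K: "0 \<le> t \<Longrightarrow> class_K (\<lambda>r. \<beta> r t)"
  using \<beta> by (simp add: class_KL_def)

lemma \<gamma>_0: "\<gamma> 0 = 0"
  using \<gamma>_K by (simp add: class_K_def)

lemma \<beta>_0: "0 \<le> t \<Longrightarrow> \<beta> 0 t = 0"
  using \<beta>_K by (simp add: class_K_def)

lemma \<beta>_mono: "0 \<le> t \<Longrightarrow> 0 \<le> r \<Longrightarrow> r \<le> r' \<Longrightarrow> \<beta> r t \<le> \<beta> r' t"
  using class_K_mono[OF \<beta>_K] by blast

lemma \<beta>_antimono: "0 \<le> r \<Longrightarrow> 0 \<le> s \<Longrightarrow> s \<le> t \<Longrightarrow> \<beta> r t \<le> \<beta> r s"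
  using \<beta> monotone_onD[of "{0..}" "(\<le>)" "(\<ge>)" "\<beta> r" s t] by (simp add: class_KL_def)

lemma \<beta>_eventually_small:
  assumes "0 \<le> r" "0 < \<eta>"
  obtains T where "1 \<le> T" "\<beta> r T < \<eta>"
proof -
  have "(\<beta> r \<longlongrightarrow> 0) at_top"
    using \<beta> assms by (simp add: class_KL_def)
  then have "\<forall>\<^sub>F t in at_top. \<beta> r t < \<eta>"
    using \<open>0 < \<eta>\<close> by (rule order_tendstoD(2))
  then have "\<forall>\<^sub>F t in at_top. \<beta> r t < \<eta> \<and> 1 \<le> t"
    using eventually_ge_at_top by (rule eventually_conj)
  then show ?thesis
    using that eventually_happens'[OF trivial_limit_at_top_linorder] by blast
qed

lemma run_exists: "u \<in> Uplus \<Longrightarrow> \<exists>x. run x0 u x"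
  using complete by (auto simp: run_def forward_complete_def)

lemma run_0: "run x0 u x \<Longrightarrow> x 0 = x0"
  by (auto simp: run_def dest: trajectory_0)

text \<open>\<delta>ISS compares runs from time 0 only; restarting makes it applicable from any
  later time, also to two runs restarted at different times.\<close>

lemma run_shift:
  assumes "run x0 u x" "0 \<le> \<tau>"
  obtains v where "run (x \<tau>) v (\<lambda>t. x (t + \<tau>))" "\<And>t. 0 \<le> t \<Longrightarrow> v t = u (t + \<tau>)"
proof -
  obtain v where "v \<in> Uplus" "\<And>t. 0 \<le> t \<Longrightarrow> v t = u (t + \<tau>)"
    using shift assms unfolding forward_shift_closed_def run_def by blast
  then show ?thesis
    using that assms trajectory_shift[of f x0 u x \<tau> v] by (simp add: run_def)
qed

lemma input_Lipschitz_on: "u \<in> Uplus \<Longrightarrow> K-lipschitz_on {0..} u"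
  using K_pos by (intro lipschitz_onI) (auto simp: dist_norm input_Lipschitz)

text \<open>Inputs are continuous, so a pointwise bound can replace the essential supremum. The
  later estimates use \<delta>ISS only in this form.\<close>

lemma run_diff_bound:
  assumes run: "run xa0 ua xa" "run xb0 ub xb" and t: "0 \<le> t"
    and C: "\<And>s. s \<in> {0..t} \<Longrightarrow> norm (ua s - ub s) \<le> C"
  shows "norm (xa t - xb t) \<le> \<beta> (norm (xa0 - xb0)) t + \<gamma> C"
proof -
  have "continuous_on {0..t} ua" "continuous_on {0..t} ub"
    using run by (auto simp: run_def
        intro!: continuous_on_subset[OF lipschitz_on_continuous_on[OF input_Lipschitz_on]])
  then have "continuous_on {0..t} (\<lambda>s. norm (ua s - ub s))"
    by (intro continuous_intros)
  then have "0 \<le> ess_sup {0..t} (\<lambda>s. norm (ua s - ub s))" "ess_sup {0..t} (\<lambda>s. norm (ua s - ub s)) \<le> C"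
    using ess_sup_Icc_bounds[OF t, of "\<lambda>s. norm (ua s - ub s)" C] C by simp_all
  then have "\<gamma> (ess_sup {0..t} (\<lambda>s. norm (ua s - ub s))) \<le> \<gamma> C"
    by (rule class_K_mono[OF \<gamma>_K])
  moreover have "norm (xa t - xb t) \<le>
      \<beta> (norm (xa0 - xb0)) t + \<gamma> (ess_sup {0..t} (\<lambda>s. norm (ua s - ub s)))"
    using run t by (intro delta_ISS) (auto simp: run_def)
  ultimately show ?thesis by linarith
qed

section \<open>A common bound for all trajectories from a bounded set\<close>

lemma run_same_input_diff_bound:
  "run a u xa \<Longrightarrow> run b u xb \<Longrightarrow> 0 \<le> t \<Longrightarrow> norm (xa t - xb t) \<le> \<beta> (norm (a - b)) t"
  using run_diff_bound[of a u xa b u xb t 0] \<gamma>_0 by simp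

lemma run_same_start_diff_bound:
  assumes "run x0 ua xa" "run x0 ub xb" "0 \<le> t"
  shows "norm (xa t - xb t) \<le> \<gamma> (2 * M)"
proof -
  have "norm (ua s - ub s) \<le> 2 * M" if "s \<in> {0..t}" for s
    using norm_triangle_ineq4[of "ua s" "ub s"] input_bound[of ua s] input_bound[of ub s] that assms
    by (simp add: run_def)
  then show ?thesis
    using run_diff_bound[of x0 ua xa x0 ub xb t "2 * M"] assms \<beta>_0 by simp
qed

text \<open>Subdividing the segment between two initial states makes the contraction at unit scale
  linear at large scale, although \<open>\<beta>\<close> is not linear in its first argument.\<close>

lemma large_scale_contraction:
  "\<exists>T\<ge>1. \<forall>a b u xa xb. run a u xa \<longrightarrow> run b u xb \<longrightarrow> norm (xa T - xb T) \<le> (norm (a - b) + 1) / 2"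
proof -
  \<comment> \<open>Under a common input, starts at distance at most 1 lead to states at distance
    below \<open>1 / 2\<close> at time \<open>T\<close>; a chain of \<open>n\<close> such pairs
    gives \<open>n / 2\<close>.\<close>
  obtain T where T: "1 \<le> T" "\<beta> 1 T < 1 / 2"
    using \<beta>_eventually_small[of 1 "1 / 2"] by auto
  have step: "norm (xa T - xb T) \<le> real n / 2"
    if "run a u xa" "run b u xb" "norm (a - b) \<le> real n" for a b u xa xb n
    using that
  proof (induction n arbitrary: a xa)
    case 0
    then show ?case
      using run_same_input_diff_bound[of a u xa b xb T] T \<beta>_0 by simp
  next
    case (Suc n)
    \<comment> \<open>The end of the first of \<open>n + 1\<close> equal pieces of the segment from
      \<open>a\<close> to \<open>b\<close>: at distance at most 1 from \<open>a\<close> and at most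
      \<open>n\<close> from \<open>b\<close>.\<close>
    define c where "c = a + (b - a) /\<^sub>R real (Suc n)"
    obtain xc where xc: "run c u xc"
      using Suc.prems run_exists unfolding run_def by blast
    have "a - c = (a - b) /\<^sub>R real (Suc n)"
      by (simp add: c_def algebra_simps)
    then have "norm (a - c) = norm (a - b) / real (Suc n)"
      by (simp add: divide_inverse_commute)
    also have "\<dots> \<le> 1"
      using Suc.prems(3) by (simp add: divide_le_eq)
    finally have ac: "norm (xa T - xc T) \<le> 1 / 2"
      using run_same_input_diff_bound[OF Suc.prems(1) xc, of T] \<beta>_mono[of T "norm (a - c)" 1] T by simp
    have "c - b = (real n / real (Suc n)) *\<^sub>R (a - b)"
    proof -
      have eq: "real n / real (Suc n) = 1 - inverse (real (Suc n))"
        by (simp add: field_simps)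
      show ?thesis
        unfolding eq c_def by (simp add: algebra_simps)
    qed
    then have "norm (c - b) = real n * (norm (a - b) / real (Suc n))"
      by simp
    also have "\<dots> \<le> real n * 1"
      using Suc.prems(3) by (intro mult_left_mono) (simp_all add: divide_le_eq)
    finally have "norm (xc T - xb T) \<le> real n / 2"
      using Suc.IH[OF xc Suc.prems(2)] by simp
    then show ?case
      using ac norm_triangle_ineq[of "xa T - xc T" "xc T - xb T"] by simp
  qed
  show ?thesis
  proof (intro exI[of _ T] conjI T(1) allI impI)
    fix a b u xa xb assume "run a u xa" "run b u xb"
    \<comment> \<open>Rounding the distance up to a whole number of unit pieces costs the summand
      1.\<close>
    then have "norm (xa T - xb T) \<le> real (nat \<lceil>norm (a - b)\<rceil>) / 2"
      by (rule step) (simp add: of_nat_ceiling)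
    also have "\<dots> \<le> (norm (a - b) + 1) / 2"
      by (simp add: of_nat_nat)
    finally show "norm (xa T - xb T) \<le> (norm (a - b) + 1) / 2" .
  qed
qed

text \<open>The last stretch of length \<open>T\<close> of a run is compared with a fresh run from 0
  under the same input. The contraction halves the distance up to a constant, and the fresh run has
  only lived for time \<open>T\<close>, where one reference run bounds it.\<close>

lemma runs_from_0_bounded: "\<exists>S. \<forall>u x t. run 0 u x \<longrightarrow> 0 \<le> t \<longrightarrow> norm (x t) \<le> S"
proof (cases "Uplus = {}")
  case True
  then show ?thesis unfolding run_def by simp
next
  case False
  then obtain ur xr where r: "run 0 ur xr"
    using run_exists by blast
  obtain T where T: "1 \<le> T"
    and contr: "\<And>a b u xa xb. run a u xa \<Longrightarrow> run b u xb \<Longrightarrow> norm (xa T - xb T) \<le> (norm (a - b) + 1) / 2"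
    using large_scale_contraction by blast
  have "continuous_on {0..T} xr"
    using r trajectory_continuous_on by (auto simp: run_def)
  then have "bounded (xr ` {0..T})"
    by (intro compact_imp_bounded compact_continuous_image) auto
  then obtain R where "\<forall>y\<in>xr ` {0..T}. norm y \<le> R"
    unfolding bounded_iff by (elim exE)
  then have R: "norm (xr t) \<le> R" if "t \<in> {0..T}" for t
    using that by blast
  define D where "D = \<gamma> (2 * M)"
  have "0 \<le> D"
    unfolding D_def using M_pos by (intro class_K_nonneg[OF \<gamma>_K]) simp
  have "0 \<le> R"
    using R[of 0] T norm_ge_zero order_trans by (metis atLeastAtMost_iff order_refl zero_le_one)
  \<comment> \<open>The solution of \<open>S = (S + 1) / 2 + (D + R)\<close>, hence a bound that
    each further stretch of length \<open>T\<close> preserves.\<close>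
  define S where "S = 1 + 2 * D + 2 * R"
  have early: "norm (x t) \<le> D + R" if "run 0 u x" "t \<in> {0..T}" for u x t
    using run_same_start_diff_bound[OF that(1) r, of t] R[OF that(2)] that(2)
      norm_triangle_ineq2[of "x t" "xr t"] by (simp add: D_def)
  have "norm (x t) \<le> S" if "run 0 u x" "0 \<le> t" "t \<le> real n * T" for u x t n
    using that
  proof (induction n arbitrary: t)
    case 0
    then have "t = 0" by simp
    then show ?case
      using run_0[OF 0(1)] \<open>0 \<le> D\<close> \<open>0 \<le> R\<close> by (simp add: S_def)
  next
    case (Suc n)
    show ?case
    proof (cases "t \<le> T")
      case True
      then show ?thesis
        using early[OF Suc.prems(1), of t] Suc.prems \<open>0 \<le> D\<close> \<open>0 \<le> R\<close> by (simp add: S_def)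
    next
      case False
      define \<tau> where "\<tau> = t - T"
      have "0 \<le> \<tau>" "\<tau> \<le> real n * T"
        using False Suc.prems by (simp_all add: \<tau>_def algebra_simps)
      then have "norm (x \<tau>) \<le> S"
        using Suc by blast
      obtain v where v: "run (x \<tau>) v (\<lambda>t. x (t + \<tau>))"
        using run_shift[OF Suc.prems(1) \<open>0 \<le> \<tau>\<close>] by blast
      then obtain y where y: "run 0 v y"
        using run_exists unfolding run_def by blast
      have "norm (x t - y T) \<le> (norm (x \<tau>) + 1) / 2"
        using contr[OF v y] by (simp add: \<tau>_def)
      moreover have "norm (y T) \<le> D + R"
        using early[OF y, of T] T by simp
      moreover have "norm (x t) \<le> norm (x t - y T) + norm (y T)"
        using norm_triangle_ineq[of "x t - y T" "y T"] by simp
      ultimately show ?thesis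
        using \<open>norm (x \<tau>) \<le> S\<close> by (simp add: S_def)
    qed
  qed
  moreover have "\<exists>n. t \<le> real n * T" for t
    using reals_Archimedean3[of T] T less_imp_le by fastforce
  ultimately show ?thesis by blast
qed

text \<open>The run from 0 with the same input is bounded already, and the monotonicity of \<beta>
  in both arguments bounds the distance to it uniformly.\<close>

lemma runs_bounded:
  assumes "bounded X0"
  obtains S where "0 < S" "\<And>x0 u x t. x0 \<in> X0 \<Longrightarrow> run x0 u x \<Longrightarrow> 0 \<le> t \<Longrightarrow> norm (x t) \<le> S"
proof -
  obtain S0 where S0: "\<And>u x t. run 0 u x \<Longrightarrow> 0 \<le> t \<Longrightarrow> norm (x t) \<le> S0"
    using runs_from_0_bounded by blast
  obtain b where b: "0 < b" "\<And>x0. x0 \<in> X0 \<Longrightarrow> norm x0 \<le> b"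
    using assms by (auto simp: bounded_pos)
  show ?thesis
  proof (rule that[of "\<bar>S0\<bar> + \<bar>\<beta> b 0\<bar> + 1"])
    fix x0 u x t assume x0: "x0 \<in> X0" and run: "run x0 u x" and t: "(0::real) \<le> t"
    then obtain y where y: "run 0 u y"
      using run_exists unfolding run_def by blast
    have "norm (x t - y t) \<le> \<beta> (norm x0) t"
      using run_same_input_diff_bound[OF run y t] by simp
    also have "\<dots> \<le> \<beta> (norm x0) 0"
      using t by (intro \<beta>_antimono) auto
    also have "\<dots> \<le> \<beta> b 0"
      using b x0 by (intro \<beta>_mono) auto
    finally show "norm (x t) \<le> \<bar>S0\<bar> + \<bar>\<beta> b 0\<bar> + 1"
      using S0[OF y t] norm_triangle_ineq2[of "x t" "y t"] by linarith
  qed simp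
qed

text \<open>The vector field is only integrable along trajectories, so the trajectories are
  compared, for short times, with finitely many reference trajectories.\<close>

lemma runs_equicontinuous_at_0:
  assumes "bounded X0" "0 < \<eta>"
  obtains \<delta> where "0 < \<delta>"
    and "\<And>x0 u x t. x0 \<in> X0 \<Longrightarrow> run x0 u x \<Longrightarrow> 0 \<le> t \<Longrightarrow> t < \<delta> \<Longrightarrow> norm (x t - x0) < \<eta>"
proof -
  \<comment> \<open>Lipschitz inputs stay near their initial values for a short time, so initial
    state and initial input value together determine the start of a run up to a small error.\<close>
  define W where "W = {(x0, u 0) |x0 u. x0 \<in> X0 \<and> u \<in> Uplus}"
  have "W \<subseteq> X0 \<times> cball 0 M"
    using input_bound by (auto simp: W_def)
  then have "bounded W"
    using bounded_subset bounded_Times[OF assms(1) bounded_cball] by blast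
  have "0 < \<eta> / 4"
    using assms by simp
  obtain \<delta>1 where \<delta>1: "0 < \<delta>1" "\<And>r. 0 \<le> r \<Longrightarrow> r \<le> \<delta>1 \<Longrightarrow> \<beta> r 0 < \<eta> / 4"
    using class_K_small[OF \<beta>_K[of 0] \<open>0 < \<eta> / 4\<close>] by auto
  obtain \<delta>2 where \<delta>2: "0 < \<delta>2" "\<And>r. 0 \<le> r \<Longrightarrow> r \<le> \<delta>2 \<Longrightarrow> \<gamma> r < \<eta> / 4"
    using class_K_small[OF \<gamma>_K \<open>0 < \<eta> / 4\<close>] by auto
  \<comment> \<open>The displacement of a run splits into a \<beta> term, a \<gamma> term, the
    displacement of the reference run and the distance of the starts, with \<open>\<eta> / 4\<close>
    for each. The inputs may differ by \<open>2 * \<rho>\<close>: half for the initial values, half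
    for the drift.\<close>
  define \<rho> where "\<rho> = Min {\<delta>1, \<delta>2 / 2, \<eta> / 4}"
  have \<rho>: "0 < \<rho>" "\<rho> \<le> \<delta>1" "2 * \<rho> \<le> \<delta>2" "\<rho> \<le> \<eta> / 4"
    using \<delta>1 \<delta>2 assms by (auto simp: \<rho>_def)
  \<comment> \<open>\<open>W\<close> need not be closed. Covering its compact closure by balls
    centred in \<open>W\<close> itself ensures that every centre belongs to an admissible
    run.\<close>
  have "closure W \<subseteq> (\<Union>w\<in>W. ball w \<rho>)"
  proof
    fix z assume "z \<in> closure W"
    then obtain w where "w \<in> W" "dist w z < \<rho>"
      using \<rho>(1) by (meson closure_approachable)
    then show "z \<in> (\<Union>w\<in>W. ball w \<rho>)"
      by auto
  qed
  then obtain W' where W': "W' \<subseteq> W" "finite W'" "closure W \<subseteq> (\<Union>w\<in>W'. ball w \<rho>)"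
    using compactE_image[of "closure W" W "\<lambda>w. ball w \<rho>"] \<open>bounded W\<close> by (auto simp: compact_closure)
  have "\<exists>u x d. run (fst w) u x \<and> u 0 = snd w \<and> 0 < d \<and>
      (\<forall>t. 0 \<le> t \<longrightarrow> t < d \<longrightarrow> norm (x t - fst w) < \<eta> / 4)" if "w \<in> W" for w
  proof -
    from that obtain u where u: "u \<in> Uplus" "u 0 = snd w"
      by (auto simp: W_def)
    then obtain x where x: "run (fst w) u x"
      using run_exists by blast
    have "continuous_on {0..1} x"
      using x trajectory_continuous_on by (auto simp: run_def)
    then obtain d where d: "0 < d" "\<And>t. t \<in> {0..1} \<Longrightarrow> dist t 0 < d \<Longrightarrow> dist (x t) (x 0) < \<eta> / 4"
      using \<open>0 < \<eta> / 4\<close> unfolding continuous_on_iff by (metis atLeastAtMost_iff order_refl zero_le_one)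
    have "norm (x t - fst w) < \<eta> / 4" if "0 \<le> t" "t < min d 1" for t
      using d(2)[of t] that run_0[OF x] by (simp add: dist_norm)
    then show ?thesis
      using u x d(1) by (intro exI[of _ u] exI[of _ x] exI[of _ "min d 1"]) auto
  qed
  then obtain uw xw dw where w: "\<And>w. w \<in> W \<Longrightarrow> run (fst w) (uw w) (xw w)"
    "\<And>w. w \<in> W \<Longrightarrow> uw w 0 = snd w" "\<And>w. w \<in> W \<Longrightarrow> 0 < dw w"
    "\<And>w t. w \<in> W \<Longrightarrow> 0 \<le> t \<Longrightarrow> t < dw w \<Longrightarrow> norm (xw w t - fst w) < \<eta> / 4"
    by metis
  define \<delta> where "\<delta> = Min (insert (\<rho> / (2 * K)) (dw ` W'))"
  have "0 < \<delta>"
    unfolding \<delta>_def using W' w(3) \<rho> K_pos by (subst Min_gr_iff) auto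
  have \<delta>_le: "\<delta> \<le> \<rho> / (2 * K)" "\<And>w. w \<in> W' \<Longrightarrow> \<delta> \<le> dw w"
    unfolding \<delta>_def using W'(2) by (auto intro!: Min_le simp del: Min_insert)
  show ?thesis
  proof (rule that[OF \<open>0 < \<delta>\<close>])
    fix x0 u x t assume x0: "x0 \<in> X0" and run: "run x0 u x" and t: "0 \<le> t" "t < \<delta>"
    have "(x0, u 0) \<in> W"
      using x0 run by (auto simp: W_def run_def)
    then have "(x0, u 0) \<in> (\<Union>w\<in>W'. ball w \<rho>)"
      using W'(3) closure_subset[of W] by (meson subsetD)
    then obtain w where w': "w \<in> W'" "dist w (x0, u 0) < \<rho>"
      by auto
    then have "w \<in> W"
      using W' by blast
    have dist_w: "norm (fst w - x0) < \<rho>" "norm (snd w - u 0) < \<rho>"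
      using w'(2) dist_fst_le[of w "(x0, u 0)"] dist_snd_le[of w "(x0, u 0)"] by (auto simp: dist_norm)
    have "norm (u s - uw w s) \<le> 2 * \<rho>" if "s \<in> {0..t}" for s
    proof -
      have "u \<in> Uplus" "uw w \<in> Uplus"
        using run w(1)[OF \<open>w \<in> W\<close>] by (auto simp: run_def)
      then have "norm (u s - u 0) \<le> K * s" "norm (uw w s - uw w 0) \<le> K * s"
        using input_Lipschitz[of u s 0] input_Lipschitz[of "uw w" s 0] that by auto
      moreover have "u s - uw w s = (u s - u 0) - (uw w s - uw w 0) - (snd w - u 0)"
        using w(2)[OF \<open>w \<in> W\<close>] by simp
      then have "norm (u s - uw w s) \<le> norm (u s - u 0) + norm (uw w s - uw w 0) + norm (snd w - u 0)"
        using norm_triangle_ineq4[of "(u s - u 0) - (uw w s - uw w 0)" "snd w - u 0"]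
          norm_triangle_ineq4[of "u s - u 0" "uw w s - uw w 0"] by simp
      moreover have "s \<le> \<rho> / (2 * K)"
        using that t \<delta>_le(1) by simp
      then have "K * s + K * s \<le> \<rho>"
        using K_pos by (simp add: field_simps)
      ultimately show ?thesis
        using dist_w(2) by linarith
    qed
    then have "norm (x t - xw w t) \<le> \<beta> (norm (x0 - fst w)) t + \<gamma> (2 * \<rho>)"
      using run_diff_bound[OF run w(1)[OF \<open>w \<in> W\<close>] t(1)] by blast
    moreover have "\<beta> (norm (x0 - fst w)) t \<le> \<beta> (norm (x0 - fst w)) 0"
      using t by (intro \<beta>_antimono) auto
    moreover have "\<beta> (norm (x0 - fst w)) 0 < \<eta> / 4"
      using dist_w(1) \<rho> by (intro \<delta>1(2)) (auto simp: norm_minus_commute)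
    moreover have "\<gamma> (2 * \<rho>) < \<eta> / 4"
      using \<rho> by (intro \<delta>2(2)) auto
    moreover have "norm (xw w t - fst w) < \<eta> / 4"
      using w(4)[OF \<open>w \<in> W\<close> t(1)] t \<delta>_le(2)[OF w'(1)] by simp
    moreover have "norm (x t - x0) \<le> norm (x t - xw w t) + norm (xw w t - fst w) + norm (fst w - x0)"
      using norm_triangle_ineq[of "x t - xw w t" "xw w t - fst w"]
        norm_triangle_ineq[of "x t - fst w" "fst w - x0"] by simp
    ultimately show "norm (x t - x0) < \<eta>"
      using dist_w(1) \<rho>(4) by linarith
  qed
qed

text \<open>The factor \<open>exp (- t)\<close> on time and initial state keeps both visible while they matter and
  lets them fade once the initial state is forgotten.\<close>

lemma runs_close:
  assumes "bounded X0" "0 < \<eta>"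
  obtains T \<delta> where "0 < T" "0 < \<delta>"
    and "\<And>x0 u x t x0' u' x' t'. \<lbrakk>x0 \<in> X0; x0' \<in> X0; run x0 u x; run x0' u' x'; 0 \<le> t; t \<le> t';
      \<bar>exp (- t) - exp (- t')\<bar> < \<delta>; norm (exp (- t) *\<^sub>R x0 - exp (- t') *\<^sub>R x0') < \<delta>;
      \<And>s. \<lbrakk>0 \<le> s; s \<le> t; s \<le> T\<rbrakk> \<Longrightarrow> norm (u (t - s) - u' (t' - s)) \<le> \<delta>\<rbrakk> \<Longrightarrow>
      norm (x t - x' t') < \<eta>"
proof -
  have "0 < \<eta> / 2"
    using assms by simp
  obtain S where S: "0 < S" "\<And>x0 u x t. x0 \<in> X0 \<Longrightarrow> run x0 u x \<Longrightarrow> 0 \<le> t \<Longrightarrow> norm (x t) \<le> S"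
    using runs_bounded[OF assms(1)] by blast
  obtain T where T: "1 \<le> T" "\<beta> (2 * S) T < \<eta> / 2"
    using \<beta>_eventually_small[of "2 * S" "\<eta> / 2"] S(1) \<open>0 < \<eta> / 2\<close> by auto
  obtain \<delta>1 where \<delta>1: "0 < \<delta>1" "\<And>r. 0 \<le> r \<Longrightarrow> r \<le> \<delta>1 \<Longrightarrow> \<gamma> r < \<eta> / 2"
    using class_K_small[OF \<gamma>_K \<open>0 < \<eta> / 2\<close>] by auto
  obtain \<delta>2 where \<delta>2: "0 < \<delta>2" "\<And>r. 0 \<le> r \<Longrightarrow> r \<le> \<delta>2 \<Longrightarrow> \<beta> r 0 < \<eta> / 2"
    using class_K_small[OF \<beta>_K[of 0] \<open>0 < \<eta> / 2\<close>] by auto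
  then have "0 < \<delta>2 / 2" by simp
  obtain \<delta>3 where \<delta>3: "0 < \<delta>3"
    "\<And>x0 u x t. x0 \<in> X0 \<Longrightarrow> run x0 u x \<Longrightarrow> 0 \<le> t \<Longrightarrow> t < \<delta>3 \<Longrightarrow> norm (x t - x0) < \<delta>2 / 2"
    using runs_equicontinuous_at_0[OF assms(1) \<open>0 < \<delta>2 / 2\<close>] by blast
  \<comment> \<open>The first entry controls the \<gamma> term. The second compensates the factor
    \<open>exp T\<close> lost when the initial state is read back at times before \<open>T\<close>.
    The third is the least change of the clock between times \<open>t < T\<close> and
    \<open>t' \<ge> t + \<delta>3\<close>, so a smaller change forces
    \<open>t' - t < \<delta>3\<close>.\<close>
  define \<delta> where "\<delta> = Min {\<delta>1, \<delta>2 / (2 * exp T * (1 + S)), exp (- T) * (1 - exp (- \<delta>3))}"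
  have "0 < \<delta>"
    using \<delta>1 \<delta>2 \<delta>3 S by (auto simp: \<delta>_def)
  have \<delta>_le: "\<delta> \<le> \<delta>1" "\<delta> \<le> \<delta>2 / (2 * exp T * (1 + S))" "\<delta> \<le> exp (- T) * (1 - exp (- \<delta>3))"
    by (auto simp: \<delta>_def)
  show ?thesis
  proof (rule that[of T \<delta>])
    fix x0 u x t x0' u' x' t'
    assume x0: "x0 \<in> X0" "x0' \<in> X0" and run: "run x0 u x" "run x0' u' x'" and t: "0 \<le> t" "t \<le> t'"
      and clock: "\<bar>exp (- t) - exp (- t')\<bar> < \<delta>"
      and init: "norm (exp (- t) *\<^sub>R x0 - exp (- t') *\<^sub>R x0') < \<delta>"
      and inputs: "\<And>s. \<lbrakk>0 \<le> s; s \<le> t; s \<le> T\<rbrakk> \<Longrightarrow> norm (u (t - s) - u' (t' - s)) \<le> \<delta>"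
    have \<gamma>\<delta>: "\<gamma> \<delta> < \<eta> / 2"
      using \<delta>1(2) \<open>0 < \<delta>\<close> \<delta>_le by simp
    show "norm (x t - x' t') < \<eta>"
    proof (cases "T \<le> t")
      case True
      \<comment> \<open>Both runs are restarted \<open>T\<close> before their current times: the
        states there differ by at most \<open>2 * S\<close>, which \<beta> forgets within time
        \<open>T\<close>.\<close>
      obtain v where v: "run (x (t - T)) v (\<lambda>s. x (s + (t - T)))" "\<And>s. 0 \<le> s \<Longrightarrow> v s = u (s + (t - T))"
        using run_shift[OF run(1), of "t - T"] True by auto
      obtain v' where v': "run (x' (t' - T)) v' (\<lambda>s. x' (s + (t' - T)))"
        "\<And>s. 0 \<le> s \<Longrightarrow> v' s = u' (s + (t' - T))"
        using run_shift[OF run(2), of "t' - T"] True t by auto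
      have "norm (v s - v' s) \<le> \<delta>" if "s \<in> {0..T}" for s
      proof -
        have "u (t - (T - s)) = v s" "u' (t' - (T - s)) = v' s"
          using v(2)[of s] v'(2)[of s] that by (simp_all add: algebra_simps)
        moreover have "norm (u (t - (T - s)) - u' (t' - (T - s))) \<le> \<delta>"
          using inputs[of "T - s"] that True by simp
        ultimately show ?thesis by simp
      qed
      then have "norm (x t - x' t') \<le> \<beta> (norm (x (t - T) - x' (t' - T))) T + \<gamma> \<delta>"
        using run_diff_bound[OF v(1) v'(1), of T \<delta>] T by simp
      moreover have "norm (x (t - T) - x' (t' - T)) \<le> 2 * S"
        using norm_triangle_ineq4[of "x (t - T)" "x' (t' - T)"]
          S(2)[OF x0(1) run(1), of "t - T"] S(2)[OF x0(2) run(2), of "t' - T"] True t by simp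
      then have "\<beta> (norm (x (t - T) - x' (t' - T))) T \<le> \<beta> (2 * S) T"
        using T by (intro \<beta>_mono) auto
      ultimately show ?thesis
        using T(2) \<gamma>\<delta> by linarith
    next
      case False
      \<comment> \<open>The second run is restarted at the small time \<tau>, so that both have the
        same time \<open>t\<close> left; by then it has barely left \<open>x0'\<close>, which in
        turn is close to \<open>x0\<close>.\<close>
      define \<tau> where "\<tau> = t' - t"
      have "0 \<le> \<tau>"
        using t by (simp add: \<tau>_def)
      have "\<tau> < \<delta>3"
      proof (rule ccontr)
        assume "\<not> \<tau> < \<delta>3"
        then have "exp (- T) * (1 - exp (- \<delta>3)) \<le> exp (- t) * (1 - exp (- \<tau>))"
          using False \<delta>3(1) by (intro mult_mono) auto
        also have "\<dots> = exp (- t) - exp (- t')"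
          by (simp add: \<tau>_def right_diff_distrib exp_add[symmetric])
        finally show False
          using clock \<delta>_le(3) by linarith
      qed
      have "norm x0' \<le> S"
        using S(2)[OF x0(2) run(2), of 0] run_0[OF run(2)] by simp
      have "norm (x0 - x0') < \<delta>2 / 2"
      proof -
        have "exp (- t) *\<^sub>R (x0 - x0') =
            (exp (- t) *\<^sub>R x0 - exp (- t') *\<^sub>R x0') - (exp (- t) - exp (- t')) *\<^sub>R x0'"
          by (simp add: algebra_simps)
        then have "exp (- t) * norm (x0 - x0') \<le>
            norm (exp (- t) *\<^sub>R x0 - exp (- t') *\<^sub>R x0') + \<bar>exp (- t) - exp (- t')\<bar> * norm x0'"
          using norm_triangle_ineq4[of "exp (- t) *\<^sub>R x0 - exp (- t') *\<^sub>R x0'" "(exp (- t) - exp (- t')) *\<^sub>R x0'"]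
          by (metis abs_exp_cancel norm_scaleR)
        also have "\<dots> < \<delta> + \<delta> * S"
          using init clock \<open>norm x0' \<le> S\<close> by (intro add_less_le_mono mult_mono) auto
        finally have "norm (x0 - x0') < exp t * (\<delta> + \<delta> * S)"
          by (simp add: exp_minus field_simps)
        also have "\<dots> \<le> exp T * (\<delta> + \<delta> * S)"
          using False \<open>0 < \<delta>\<close> S(1) by (intro mult_right_mono) auto
        also have "\<dots> = \<delta> * (2 * exp T * (1 + S)) / 2"
          by (simp add: algebra_simps)
        also have "\<dots> \<le> \<delta>2 / 2"
          using \<delta>_le(2) S(1) pos_le_divide_eq[of "2 * exp T * (1 + S)" \<delta> \<delta>2] by simp
        finally show ?thesis .
      qed
      moreover have "norm (x' \<tau> - x0') < \<delta>2 / 2"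
        using \<delta>3(2)[OF x0(2) run(2)] \<open>0 \<le> \<tau>\<close> \<open>\<tau> < \<delta>3\<close> by blast
      moreover have "norm (x0 - x' \<tau>) \<le> norm (x0 - x0') + norm (x' \<tau> - x0')"
        using norm_triangle_ineq4[of "x0 - x0'" "x' \<tau> - x0'"] by simp
      ultimately have "norm (x0 - x' \<tau>) \<le> \<delta>2"
        by linarith
      then have "\<beta> (norm (x0 - x' \<tau>)) 0 < \<eta> / 2"
        by (intro \<delta>2(2)) auto
      moreover have "\<beta> (norm (x0 - x' \<tau>)) t \<le> \<beta> (norm (x0 - x' \<tau>)) 0"
        using t by (intro \<beta>_antimono) auto
      moreover obtain v' where v': "run (x' \<tau>) v' (\<lambda>s. x' (s + \<tau>))" "\<And>s. 0 \<le> s \<Longrightarrow> v' s = u' (s + \<tau>)"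
        using run_shift[OF run(2) \<open>0 \<le> \<tau>\<close>] by auto
      have "norm (u s - v' s) \<le> \<delta>" if "s \<in> {0..t}" for s
      proof -
        have "u' (t' - (t - s)) = v' s"
          using v'(2)[of s] that by (simp add: \<tau>_def algebra_simps)
        then show ?thesis
          using inputs[of "t - s"] that False by simp
      qed
      then have "norm (x t - x' t') \<le> \<beta> (norm (x0 - x' \<tau>)) t + \<gamma> \<delta>"
        using run_diff_bound[OF run(1) v'(1), of t \<delta>] t by (simp add: \<tau>_def)
      ultimately show ?thesis
        using \<gamma>\<delta> by linarith
    qed
  qed (use T \<open>0 < \<delta>\<close> in auto)
qed

section \<open>Approximation of the output\<close>

lemma input_component:
  assumes "u \<in> Uplus" "0 \<le> t"
  shows "K-lipschitz_on {0..t} (\<lambda>s. vec_nth (u (t - s)) j)"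
    and "s \<in> {0..t} \<Longrightarrow> \<bar>vec_nth (u (t - s)) j\<bar> \<le> M"
proof -
  show "K-lipschitz_on {0..t} (\<lambda>s. vec_nth (u (t - s)) j)"
  proof (rule lipschitz_onI)
    fix r s assume rs: "r \<in> {0..t}" "s \<in> {0..t}"
    have "\<bar>vec_nth (u (t - r)) j - vec_nth (u (t - s)) j\<bar> \<le> norm (u (t - r) - u (t - s))"
      using component_le_norm_cart[of "u (t - r) - u (t - s)" j] by simp
    also have "\<dots> \<le> K * \<bar>(t - r) - (t - s)\<bar>"
      using rs by (intro input_Lipschitz[OF assms(1)]) auto
    finally show "dist (vec_nth (u (t - r)) j) (vec_nth (u (t - s)) j) \<le> K * dist r s"
      by (simp add: dist_real_def abs_minus_commute)
  qed (use K_pos in simp)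
  show "\<bar>vec_nth (u (t - s)) j\<bar> \<le> M" if "s \<in> {0..t}"
    using component_le_norm_cart[of "u (t - s)" j] input_bound[OF assms(1), of "t - s"] that by simp
qed

text \<open>This joins \<open>runs_close\<close> with the recovery of recent inputs from moments.
  The current input value serves as the value at lag 0 that short histories need. Both ingredients
  assume \<open>t \<le> t'\<close>; the other order follows by symmetry.\<close>

lemma features_determine_state:
  assumes "bounded X0" "0 < \<eta>"
  shows "\<exists>N \<delta>. 0 < \<delta> \<and> (\<forall>x0 u x t x0' u' x' t'. x0 \<in> X0 \<longrightarrow> x0' \<in> X0 \<longrightarrow> run x0 u x \<longrightarrow> run x0' u' x' \<longrightarrow>
    0 \<le> t \<longrightarrow> 0 \<le> t' \<longrightarrow> \<bar>exp (- t) - exp (- t')\<bar> < \<delta> \<longrightarrow>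
    (\<forall>i. \<bar>exp (- t) * vec_nth x0 i - exp (- t') * vec_nth x0' i\<bar> < \<delta>) \<longrightarrow>
    (\<forall>j. \<bar>vec_nth (u t) j - vec_nth (u' t') j\<bar> < \<delta>) \<longrightarrow>
    (\<forall>k\<in>{1..N}. \<forall>j. \<bar>exp_moment k t (\<lambda>s. vec_nth (u (t - s)) j) -
      exp_moment k t' (\<lambda>s. vec_nth (u' (t' - s)) j)\<bar> < \<delta>) \<longrightarrow>
    norm (x t - x' t') < \<eta>)"
proof -
  obtain T \<delta>1 where T: "0 < T" and \<delta>1: "0 < \<delta>1"
    and close: "\<And>x0 u x t x0' u' x' t'. \<lbrakk>x0 \<in> X0; x0' \<in> X0; run x0 u x; run x0' u' x'; 0 \<le> t; t \<le> t';
      \<bar>exp (- t) - exp (- t')\<bar> < \<delta>1; norm (exp (- t) *\<^sub>R x0 - exp (- t') *\<^sub>R x0') < \<delta>1;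
      \<And>s. \<lbrakk>0 \<le> s; s \<le> t; s \<le> T\<rbrakk> \<Longrightarrow> norm (u (t - s) - u' (t' - s)) \<le> \<delta>1\<rbrakk> \<Longrightarrow>
      norm (x t - x' t') < \<eta>"
    using runs_close[OF assms] by metis
  define \<eta>' where "\<eta>' = \<delta>1 / real CARD('u)"
  have "0 < \<eta>'"
    using \<delta>1 by (simp add: \<eta>'_def)
  obtain N \<delta>2 where \<delta>2: "0 < \<delta>2"
    and recover: "\<And>t t' w w' s. \<lbrakk>t \<le> t'; K-lipschitz_on {0..t} w; K-lipschitz_on {0..t'} w';
      \<And>s. s \<in> {0..t} \<Longrightarrow> \<bar>w s\<bar> \<le> M; \<And>s. s \<in> {0..t'} \<Longrightarrow> \<bar>w' s\<bar> \<le> M;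
      \<bar>w 0 - w' 0\<bar> \<le> \<delta>2; \<And>k. k \<in> {1..N} \<Longrightarrow> \<bar>exp_moment k t w - exp_moment k t' w'\<bar> \<le> \<delta>2;
      0 \<le> s; s \<le> t; s \<le> T\<rbrakk> \<Longrightarrow> \<bar>w s - w' s\<bar> \<le> \<eta>'"
    using exp_moments_determine_Lipschitz_signal[of K M T \<eta>'] K_pos M_pos T \<open>0 < \<eta>'\<close>
    by (metis less_imp_le)
  \<comment> \<open>The factor 2 yields the strict inequality for the faded initial state from a
    non-strict sum over coordinates.\<close>
  define \<delta> where "\<delta> = Min {\<delta>1, \<delta>1 / (2 * real CARD('x)), \<delta>2}"
  have "0 < \<delta>"
    using \<delta>1 \<delta>2 by (auto simp: \<delta>_def)
  have \<delta>_le: "\<delta> \<le> \<delta>1" "\<delta> \<le> \<delta>1 / (2 * real CARD('x))" "\<delta> \<le> \<delta>2"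
    by (auto simp: \<delta>_def)
  have ordered: "norm (x t - x' t') < \<eta>"
    if x0: "x0 \<in> X0" "x0' \<in> X0" and run: "run x0 u x" "run x0' u' x'" and t: "0 \<le> t" "t \<le> t'"
      and clock: "\<bar>exp (- t) - exp (- t')\<bar> < \<delta>"
      and init: "\<forall>i. \<bar>exp (- t) * vec_nth x0 i - exp (- t') * vec_nth x0' i\<bar> < \<delta>"
      and now: "\<forall>j. \<bar>vec_nth (u t) j - vec_nth (u' t') j\<bar> < \<delta>"
      and mom: "\<forall>k\<in>{1..N}. \<forall>j. \<bar>exp_moment k t (\<lambda>s. vec_nth (u (t - s)) j) -
        exp_moment k t' (\<lambda>s. vec_nth (u' (t' - s)) j)\<bar> < \<delta>"
    for x0 u x t x0' u' x' t'
  proof (rule close[OF x0 run t])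
    have u: "u \<in> Uplus" "u' \<in> Uplus"
      using run by (simp_all add: run_def)
    show "\<bar>exp (- t) - exp (- t')\<bar> < \<delta>1"
      using clock \<delta>_le by linarith
    have "norm (exp (- t) *\<^sub>R x0 - exp (- t') *\<^sub>R x0') \<le> real CARD('x) * \<delta>"
      by (rule norm_diff_le_if_components) (simp add: init less_imp_le)
    also have "\<dots> < \<delta>1"
      using \<delta>_le(2) \<delta>1 by (simp add: field_simps)
    finally show "norm (exp (- t) *\<^sub>R x0 - exp (- t') *\<^sub>R x0') < \<delta>1" .
    fix s assume s: "0 \<le> s" "s \<le> t" "s \<le> T"
    have "\<bar>vec_nth (u (t - s)) j - vec_nth (u' (t' - s)) j\<bar> \<le> \<eta>'" for j
    proof (rule recover[where w = "\<lambda>s. vec_nth (u (t - s)) j" and w' = "\<lambda>s. vec_nth (u' (t' - s)) j",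
          OF t(2) _ _ _ _ _ _ s])
      show "\<bar>vec_nth (u (t - 0)) j - vec_nth (u' (t' - 0)) j\<bar> \<le> \<delta>2"
        using now[rule_format, of j] \<delta>_le(3) by simp
      show "\<bar>exp_moment k t (\<lambda>s. vec_nth (u (t - s)) j) - exp_moment k t' (\<lambda>s. vec_nth (u' (t' - s)) j)\<bar> \<le> \<delta>2"
        if "k \<in> {1..N}" for k
        using mom[rule_format, OF that, of j] \<delta>_le(3) by linarith
    qed (use u t input_component in auto)
    then have "norm (u (t - s) - u' (t' - s)) \<le> real CARD('u) * \<eta>'"
      by (rule norm_diff_le_if_components)
    then show "norm (u (t - s) - u' (t' - s)) \<le> \<delta>1"
      by (simp add: \<eta>'_def)
  qed
  show ?thesis
  proof (intro exI conjI allI impI)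
    fix x0 u x t x0' u' x' t'
    assume *: "x0 \<in> X0" "x0' \<in> X0" "run x0 u x" "run x0' u' x'" "0 \<le> t" "0 \<le> t'"
      "\<bar>exp (- t) - exp (- t')\<bar> < \<delta>"
      "\<forall>i. \<bar>exp (- t) * vec_nth x0 i - exp (- t') * vec_nth x0' i\<bar> < \<delta>"
      "\<forall>j. \<bar>vec_nth (u t) j - vec_nth (u' t') j\<bar> < \<delta>"
      "\<forall>k\<in>{1..N}. \<forall>j. \<bar>exp_moment k t (\<lambda>s. vec_nth (u (t - s)) j) -
        exp_moment k t' (\<lambda>s. vec_nth (u' (t' - s)) j)\<bar> < \<delta>"
    show "norm (x t - x' t') < \<eta>"
    proof (cases "t \<le> t'")
      case True
      show ?thesis
        by (rule ordered) (fact * True)+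
    next
      case False
      have "norm (x' t' - x t) < \<eta>"
      proof (rule ordered)
        show "t' \<le> t"
          using False by simp
        show "\<bar>exp (- t') - exp (- t)\<bar> < \<delta>"
          using *(7) by (simp add: abs_minus_commute)
        show "\<forall>i. \<bar>exp (- t') * vec_nth x0' i - exp (- t) * vec_nth x0 i\<bar> < \<delta>"
          using *(8) by (simp add: abs_minus_commute)
        show "\<forall>j. \<bar>vec_nth (u' t') j - vec_nth (u t) j\<bar> < \<delta>"
          using *(9) by (simp add: abs_minus_commute)
        show "\<forall>k\<in>{1..N}. \<forall>j. \<bar>exp_moment k t' (\<lambda>s. vec_nth (u' (t' - s)) j) -
            exp_moment k t (\<lambda>s. vec_nth (u (t - s)) j)\<bar> < \<delta>"
          using *(10) by (simp add: abs_minus_commute)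
      qed (fact *)+
      then show ?thesis
        by (simp add: norm_minus_commute)
    qed
  qed (fact \<open>0 < \<delta>\<close>)
qed

text \<open>A triple \<open>(\<lambda>, b, \<zeta>)\<close> in the set \<open>J\<close> below stands for a scalar filter with pole \<open>- \<lambda>\<close>,
  input row \<open>b\<close> and initial value \<open>\<zeta> x0\<close>.\<close>

lemma output_approximation:
  fixes g :: "real^'x \<Rightarrow> real^'u \<Rightarrow> real^'y"
  assumes X0: "bounded X0" and g: "smooth_output_map g" and "0 < \<epsilon>"
  shows "\<exists>m A B h. A \<in> carrier_mat m m \<and> hurwitz A \<and> smooth_readout m h \<and>
    (\<forall>x0\<in>X0. \<exists>z0\<in>carrier_vec m. \<forall>u\<in>Uplus. \<forall>x. trajectory f x0 u x \<longrightarrow>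
      (\<forall>t\<ge>0. norm (g (x t) (u t) - h (linear_state m A B z0 u t) (u t)) < \<epsilon>))"
proof -
  define \<epsilon>' where "\<epsilon>' = \<epsilon> / (2 * real CARD('y))"
  have "0 < \<epsilon>'"
    using \<open>0 < \<epsilon>\<close> by (simp add: \<epsilon>'_def)
  obtain S where S: "0 < S" "\<And>x0 u x t. x0 \<in> X0 \<Longrightarrow> run x0 u x \<Longrightarrow> 0 \<le> t \<Longrightarrow> norm (x t) \<le> S"
    using runs_bounded[OF X0] by blast
  \<comment> \<open>All states and input values that occur lie in this compact set, on which
    \<open>g\<close> is bounded and uniformly continuous.\<close>
  define Q where "Q = cball (0 :: real^'x) S \<times> cball (0 :: real^'u) M"
  have "compact Q"
    unfolding Q_def by (intro compact_Times compact_cball)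
  have gQ: "continuous_on Q (\<lambda>(a, b). g a b)"
    using smooth_output_map_continuous[OF g] continuous_on_subset by blast
  then have "bounded ((\<lambda>(a, b). g a b) ` Q)"
    using \<open>compact Q\<close> by (intro compact_imp_bounded compact_continuous_image)
  then obtain D where "\<forall>y\<in>(\<lambda>(a, b). g a b) ` Q. norm y \<le> D"
    unfolding bounded_iff by (elim exE)
  then have D: "norm (g a b) \<le> D" if "(a, b) \<in> Q" for a b
    using that by force
  have "uniformly_continuous_on Q (\<lambda>(a, b). g a b)"
    using gQ \<open>compact Q\<close> by (rule compact_uniformly_continuous)
  then obtain \<eta> where \<eta>: "0 < \<eta>" and
    "\<forall>z\<in>Q. \<forall>z'\<in>Q. dist z' z < \<eta> \<longrightarrow> dist (case z' of (a, b) \<Rightarrow> g a b) (case z of (a, b) \<Rightarrow> g a b) < \<epsilon>'"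
    unfolding uniformly_continuous_on_def using \<open>0 < \<epsilon>'\<close> by blast
  then have uc: "norm (g a b - g a' b') < \<epsilon>'"
    if "(a, b) \<in> Q" "(a', b') \<in> Q" "dist (a, b) (a', b') < \<eta>" for a b a' b'
    using that by (force simp: dist_norm)
  have "0 < \<eta> / 2"
    using \<eta> by simp
  obtain N \<delta>1 where \<delta>1: "0 < \<delta>1" and
    det: "\<forall>x0 u x t x0' u' x' t'. x0 \<in> X0 \<longrightarrow> x0' \<in> X0 \<longrightarrow> run x0 u x \<longrightarrow> run x0' u' x' \<longrightarrow>
    0 \<le> t \<longrightarrow> 0 \<le> t' \<longrightarrow> \<bar>exp (- t) - exp (- t')\<bar> < \<delta>1 \<longrightarrow>
    (\<forall>i. \<bar>exp (- t) * vec_nth x0 i - exp (- t') * vec_nth x0' i\<bar> < \<delta>1) \<longrightarrow>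
    (\<forall>j. \<bar>vec_nth (u t) j - vec_nth (u' t') j\<bar> < \<delta>1) \<longrightarrow>
    (\<forall>k\<in>{1..N}. \<forall>j. \<bar>exp_moment k t (\<lambda>s. vec_nth (u (t - s)) j) -
      exp_moment k t' (\<lambda>s. vec_nth (u' (t' - s)) j)\<bar> < \<delta>1) \<longrightarrow>
    norm (x t - x' t') < \<eta> / 2"
    using features_determine_state[OF X0 \<open>0 < \<eta> / 2\<close>] by (elim exE conjE)
  define \<delta> where "\<delta> = min \<delta>1 (\<eta> / (4 * real CARD('u)))"
  have \<delta>: "0 < \<delta>" "\<delta> \<le> \<delta>1" "\<delta> \<le> \<eta> / (4 * real CARD('u))"
    using \<delta>1 \<eta> by (auto simp: \<delta>_def)

  \<comment> \<open>Filters with a nonzero initial value have zero input row and vice versa, so each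
    state is one pure feature: the clock, a coordinate of the faded initial state, or a moment.
    Using a set leaves the numbering to \<open>e\<close>.\<close>
  define J where "J = insert (1 :: real, 0 :: real^'u, \<lambda>x0 :: real^'x. 1 :: real)
    (range (\<lambda>i. (1, 0, \<lambda>x0. vec_nth x0 i)) \<union>
     (\<lambda>(k, j). (real k, axis j 1, \<lambda>x0. 0)) ` ({1..N} \<times> UNIV))"
  have "finite J"
    by (simp add: J_def)
  then obtain e where e: "bij_betw e {0..<card J} J"
    using ex_bij_betw_nat_finite by blast
  define m where "m = card J"
  define A where "A = diagonal_matrix m (\<lambda>i. - fst (e i))"
  define B where "B i = fst (snd (e i))" for i
  define z0 where "z0 x0 = Matrix.vec m (\<lambda>i. snd (snd (e i)) x0)" for x0
  have eJ: "e i \<in> J" if "i < m" for i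
    using e that by (auto simp: m_def bij_betw_def)
  have Je: "\<exists>i<m. c = e i" if "c \<in> J" for c
  proof -
    have "c \<in> e ` {0..<card J}"
      using e that by (simp add: bij_betw_def)
    then show ?thesis
      by (auto simp: m_def)
  qed
  \<comment> \<open>All poles are negative because the moments start at
    \<open>k = 1\<close>.\<close>
  have "hurwitz A"
    unfolding A_def using eJ by (intro hurwitz_diagonal_matrix) (force simp: J_def)

  \<comment> \<open>The state of the filter \<open>c\<close>, indexed by the triple itself so that
    features can be computed without reference to the numbering.\<close>
  define \<phi> where "\<phi> c x0 u t = exp (t * - fst c) * snd (snd c) x0 +
    integral {0..t} (\<lambda>s. exp ((t - s) * - fst c) * inner (fst (snd c)) (u s))"
    for c :: "real \<times> (real^'u) \<times> (real^'x \<Rightarrow> real)" and x0 u t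
  have \<phi>_clock: "\<phi> (1, 0, \<lambda>x0. 1) x0 u t = exp (- t)"
    and \<phi>_init: "\<phi> (1, 0, \<lambda>x0. vec_nth x0 i) x0 u t = exp (- t) * vec_nth x0 i" for x0 u t i
    by (simp_all add: \<phi>_def)
  have \<phi>_moment: "\<phi> (real k, axis j 1, \<lambda>x0. 0) x0 u t = exp_moment k t (\<lambda>s. vec_nth (u (t - s)) j)"
    for k j x0 u t
    using integral_Icc_reflect[of t "\<lambda>s. exp (- (real k * s)) * vec_nth (u (t - s)) j"]
    by (simp add: \<phi>_def exp_moment_def inner_axis' mult.commute)
  have state: "vec_index (linear_state m A B (z0 x0) u t) i = \<phi> (e i) x0 u t" if "i < m" for x0 u t i
    using that by (simp add: A_def linear_state_diagonal_matrix z0_def \<phi>_def B_def)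

  obtain b where b: "\<And>x0. x0 \<in> X0 \<Longrightarrow> norm x0 \<le> b"
    using X0 by (auto simp: bounded_iff)
  define C where "C = 1 + \<bar>b\<bar> + M"
  have \<phi>_bound: "\<bar>\<phi> c x0 u t\<bar> \<le> C" if "c \<in> J" "x0 \<in> X0" "run x0 u x" "0 \<le> t" for c x0 u x t
  proof -
    have u: "u \<in> Uplus"
      using that by (simp add: run_def)
    consider "c = (1, 0, \<lambda>x0. 1)" | i where "c = (1, 0, \<lambda>x0. vec_nth x0 i)"
      | k j where "k \<in> {1..N}" "c = (real k, axis j 1, \<lambda>x0. 0)"
      using \<open>c \<in> J\<close> unfolding J_def by auto
    then show ?thesis
    proof cases
      case 1
      have "exp (- t) \<le> 1"
        using \<open>0 \<le> t\<close> by simp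
      then show ?thesis
        unfolding 1 \<phi>_clock C_def abs_exp_cancel using M_pos by linarith
    next
      case 2
      have "exp (- t) * \<bar>vec_nth x0 i\<bar> \<le> 1 * \<bar>b\<bar>"
        using component_le_norm_cart[of x0 i] b[OF \<open>x0 \<in> X0\<close>] \<open>0 \<le> t\<close> by (intro mult_mono) auto
      then show ?thesis
        using 2 \<phi>_init M_pos by (simp add: C_def abs_mult)
    next
      case 3
      have "\<bar>exp_moment k t (\<lambda>s. vec_nth (u (t - s)) j)\<bar> \<le> M"
        using 3 \<open>0 \<le> t\<close> input_component[OF u \<open>0 \<le> t\<close>]
        by (intro exp_moment_bound) (auto intro: lipschitz_on_continuous_on)
      then show ?thesis
        using 3 \<phi>_moment by (simp add: C_def)
    qed
  qed

  \<comment> \<open>One sample point for each run and each time: time is part of the sample, so a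
    single approximation on \<open>P\<close> is uniform in \<open>t\<close>.\<close>
  define P where "P = {(x0, u, x, t :: real). x0 \<in> X0 \<and> run x0 u x \<and> 0 \<le> t}"
  define \<Phi> where "\<Phi> = (\<lambda>(x0, u, x :: real \<Rightarrow> real^'x, t) k.
    case k of Inl i \<Rightarrow> \<phi> (e i) x0 u t | Inr j \<Rightarrow> vec_nth (u t) j)"
  define F where "F = (\<lambda>(x0 :: real^'x, u, x, t :: real). g (x t) (u t))"
  define I where "I = {..<m} <+> (UNIV :: 'u set)"
  have inQ: "(x t, u t) \<in> Q" if "x0 \<in> X0" "run x0 u x" "0 \<le> t" for x0 u x t
    using S(2)[OF that] input_bound[of u t] that by (simp add: Q_def run_def)
  have "\<exists>H. C_infinity I H \<and> (\<forall>p q. (\<forall>i\<in>I. p i = q i) \<longrightarrow> H p = H q) \<and>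
      (\<forall>p\<in>P. norm (H (\<Phi> p) - F p) < 2 * real CARD('y) * \<epsilon>')"
  proof (rule smooth_approximation_via_features[where \<Phi> = \<Phi> and F = F and I = I and P = P
        and C = C and D = D and \<delta> = \<delta> and \<epsilon> = \<epsilon>' and J = I])
    show "finite I"
      by (simp add: I_def)
    show "\<bar>\<Phi> p i\<bar> \<le> C" if p: "p \<in> P" and i: "i \<in> I" for p i
    proof -
      obtain x0 u x t where p': "p = (x0, u, x, t)" "x0 \<in> X0" "run x0 u x" "0 \<le> t"
        using p by (auto simp: P_def)
      show ?thesis
      proof (cases i)
        case (Inl l)
        then have "l < m"
          using i by (auto simp: I_def)
        then show ?thesis
          using \<phi>_bound[OF eJ p'(2-4)] Inl by (simp add: \<Phi>_def p'(1))
      next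
        case (Inr j)
        have "\<bar>vec_nth (u t) j\<bar> \<le> C"
          using component_le_norm_cart[of "u t" j] input_bound[of u t] p' by (simp add: run_def C_def)
        then show ?thesis
          by (simp add: Inr \<Phi>_def p'(1))
      qed
    qed
    show "norm (F p) \<le> D" if p: "p \<in> P" for p
      using that D inQ by (auto simp: P_def F_def)
    show "norm (F p - F q) < \<epsilon>'"
      if pq: "p \<in> P" "q \<in> P" and near: "\<And>i. i \<in> I \<Longrightarrow> \<bar>\<Phi> p i - \<Phi> q i\<bar> < \<delta>" for p q
    proof -
      obtain x0 u x t where p: "p = (x0, u, x, t)" "x0 \<in> X0" "run x0 u x" "0 \<le> t"
        using pq by (auto simp: P_def)
      obtain x0' u' x' t' where q: "q = (x0', u', x', t')" "x0' \<in> X0" "run x0' u' x'" "0 \<le> t'"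
        using pq by (auto simp: P_def)
      have \<phi>_near: "\<bar>\<phi> c x0 u t - \<phi> c x0' u' t'\<bar> < \<delta>" if "c \<in> J" for c
      proof -
        obtain i where "i < m" "c = e i"
          using Je[OF \<open>c \<in> J\<close>] by blast
        then show ?thesis
          using near[of "Inl i"] by (simp add: I_def \<Phi>_def p(1) q(1) InlI)
      qed
      have u_near: "\<bar>vec_nth (u t) j - vec_nth (u' t') j\<bar> < \<delta>" for j
        using near[of "Inr j"] by (simp add: I_def \<Phi>_def p(1) q(1) InrI)
      have "norm (x t - x' t') < \<eta> / 2"
      proof (rule det[rule_format, OF p(2) q(2) p(3) q(3) p(4) q(4)])
        show "\<bar>exp (- t) - exp (- t')\<bar> < \<delta>1"
          using \<phi>_near[of "(1, 0, \<lambda>x0. 1)"] \<delta>(2) by (simp add: \<phi>_clock J_def)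
        show "\<bar>exp (- t) * vec_nth x0 i - exp (- t') * vec_nth x0' i\<bar> < \<delta>1" for i
          using \<phi>_near[of "(1, 0, \<lambda>x0. vec_nth x0 i)"] \<delta>(2) by (simp add: \<phi>_init J_def)
        show "\<bar>vec_nth (u t) j - vec_nth (u' t') j\<bar> < \<delta>1" for j
          using u_near[of j] \<delta>(2) by linarith
        show "\<bar>exp_moment k t (\<lambda>s. vec_nth (u (t - s)) j) -
            exp_moment k t' (\<lambda>s. vec_nth (u' (t' - s)) j)\<bar> < \<delta>1" if k: "k \<in> {1..N}" for k j
        proof -
          have "(real k, axis j 1, \<lambda>x0. 0) \<in> J"
            unfolding J_def using k by (intro insertI2 UnI2 image_eqI[where x = "(k, j)"]) auto
          then show ?thesis
            using \<phi>_near[of "(real k, axis j 1, \<lambda>x0. 0)"] \<delta>(2) by (simp add: \<phi>_moment)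
        qed
      qed
      moreover have "norm (u t - u' t') \<le> real CARD('u) * \<delta>"
        by (rule norm_diff_le_if_components) (rule less_imp_le[OF u_near])
      then have "norm (u t - u' t') < \<eta> / 2"
        using \<delta>(3) \<eta> by (simp add: field_simps)
      moreover have "dist (x t, u t) (x' t', u' t') \<le> norm (x t - x' t') + norm (u t - u' t')"
        unfolding dist_Pair_Pair by (simp add: dist_norm sqrt_sum_squares_le_sum)
      ultimately show ?thesis
        using uc[OF inQ[OF p(2-4)] inQ[OF q(2-4)]] by (simp add: F_def p(1) q(1))
    qed
  qed (fact \<delta>(1) \<open>0 < \<epsilon>'\<close>)+
  then obtain H where H: "C_infinity I H" "\<forall>p q. (\<forall>i\<in>I. p i = q i) \<longrightarrow> H p = H q"
    and approx: "\<forall>p\<in>P. norm (H (\<Phi> p) - F p) < 2 * real CARD('y) * \<epsilon>'"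
    by (elim exE conjE)

  \<comment> \<open>\<open>H\<close> ignores indices from \<open>m\<close> on, so what
    \<open>vec_index\<close> returns out of range does not matter.\<close>
  define h where "h z v = H (\<lambda>k. case k of Inl i \<Rightarrow> vec_index z i | Inr j \<Rightarrow> vec_nth v j)" for z v
  have "(\<lambda>p. h (Matrix.vec m (\<lambda>i. p (Inl i))) (\<chi> j. p (Inr j))) = H"
    unfolding h_def by (intro ext H(2)[rule_format]) (auto simp: I_def)
  then have "smooth_readout m h"
    using H(1) by (simp add: smooth_readout_def I_def)
  moreover have "norm (g (x t) (u t) - h (linear_state m A B (z0 x0) u t) (u t)) < \<epsilon>"
    if "x0 \<in> X0" "u \<in> Uplus" "trajectory f x0 u x" "0 \<le> t" for x0 u x t
  proof -
    have "h (linear_state m A B (z0 x0) u t) (u t) = H (\<Phi> (x0, u, x, t))"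
      unfolding h_def by (rule H(2)[rule_format]) (auto simp: I_def \<Phi>_def state)
    moreover have "norm (H (\<Phi> (x0, u, x, t)) - F (x0, u, x, t)) < 2 * real CARD('y) * \<epsilon>'"
      using that by (intro approx[rule_format]) (simp add: P_def run_def)
    ultimately show ?thesis
      by (simp add: F_def \<epsilon>'_def norm_minus_commute)
  qed
  moreover have "A \<in> carrier_mat m m"
    by (simp add: A_def diagonal_matrix_carrier)
  moreover have "z0 x0 \<in> carrier_vec m" for x0
    by (simp add: z0_def)
  ultimately show ?thesis
    using \<open>hurwitz A\<close> by blast
qed

end

theorem theorem5:
  fixes f :: "real^'x \<Rightarrow> real^'u \<Rightarrow> real^'x"
    and g :: "real^'x \<Rightarrow> real^'u \<Rightarrow> real^'y"
    and Uplus :: "(real \<Rightarrow> real^'u) set"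
    and X0 :: "(real^'x) set"
    and U :: "(real \<Rightarrow> real^'u) set"
    and Y :: "(real \<Rightarrow> real^'y) set"
    and M K :: real
  assumes "U \<subseteq> L_inf UNIV" and "Y \<subseteq> L_inf UNIV"
    and "Uplus \<subseteq> L_inf {0..}"
    and "Uplus \<subseteq> positive_restrictions U"
    and "forward_shift_closed Uplus"
    and "forward_complete f Uplus"
    and "smooth_output_map g"
    and "globally_delta_ISS f Uplus"
    and "M > 0" and "K > 0"
    and "\<forall>u\<in>Uplus. \<forall>t\<ge>0. norm (u t) \<le> M"
    and "\<forall>u\<in>Uplus. \<forall>t\<ge>0. \<forall>s\<ge>0. norm (u t - u s) \<le> K * \<bar>t - s\<bar>"
  shows
    "(\<forall>x0\<in>X0. \<forall>\<epsilon>>0. \<exists>m A B z0 h.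
        A \<in> carrier_mat m m \<and> hurwitz A \<and> z0 \<in> carrier_vec m \<and> smooth_readout m h \<and>
        (\<forall>u\<in>Uplus. \<forall>x. trajectory f x0 u x \<longrightarrow>
           (\<forall>t\<ge>0. norm (g (x t) (u t) - h (linear_state m A B z0 u t) (u t)) < \<epsilon>))) \<and>
     (compact X0 \<and> realization_assumption U Y f g Uplus X0 \<longrightarrow>
      (\<forall>\<epsilon>>0. \<exists>m A B h.
        A \<in> carrier_mat m m \<and> hurwitz A \<and> smooth_readout m h \<and>
        (\<forall>x0\<in>X0. \<exists>z0\<in>carrier_vec m.
          \<forall>u\<in>Uplus. \<forall>x. trajectory f x0 u x \<longrightarrow>
            (\<forall>t\<ge>0. norm (g (x t) (u t) - h (linear_state m A B z0 u t) (u t)) < \<epsilon>))))"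
proof -
  obtain \<beta> \<gamma> where \<beta>\<gamma>: "class_KL \<beta>" "class_K_inf \<gamma>"
    and diss: "\<forall>xa0 xb0. \<forall>ua\<in>Uplus. \<forall>ub\<in>Uplus. \<forall>xa xb.
      trajectory f xa0 ua xa \<longrightarrow> trajectory f xb0 ub xb \<longrightarrow>
      (\<forall>t\<ge>0. norm (xa t - xb t) \<le> \<beta> (norm (xa0 - xb0)) t + \<gamma> (ess_sup {0..t} (\<lambda>s. norm (ua s - ub s))))"
    using assms(8) unfolding globally_delta_ISS_def by (elim exE conjE)
  interpret delta_ISS_model f Uplus \<beta> \<gamma> M K
  proof
    show "norm (xa t - xb t) \<le> \<beta> (norm (xa0 - xb0)) t + \<gamma> (ess_sup {0..t} (\<lambda>s. norm (ua s - ub s)))"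
      if "ua \<in> Uplus" "ub \<in> Uplus" "trajectory f xa0 ua xa" "trajectory f xb0 ub xb" "0 \<le> t"
      for ua ub xa0 xb0 xa xb t
      by (rule diss[rule_format]) (fact that)+
    show "norm (u t) \<le> M" if "u \<in> Uplus" "0 \<le> t" for u t
      by (rule assms(11)[rule_format]) (fact that)+
    show "norm (u t - u s) \<le> K * \<bar>t - s\<bar>" if "u \<in> Uplus" "0 \<le> t" "0 \<le> s" for u t s
      by (rule assms(12)[rule_format]) (fact that)+
  qed (fact assms \<beta>\<gamma>)+
  show ?thesis
  proof (intro conjI ballI allI impI)
    fix x0 and \<epsilon> :: real assume "0 < \<epsilon>"
    \<comment> \<open>The singleton is a bounded set of initial states, and its only
      \<open>z0\<close> can be fixed along with the system.\<close>
    obtain m A B h where AB: "A \<in> carrier_mat m m" "hurwitz A" "smooth_readout m h"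
      and ex: "\<forall>x0\<in>{x0}. \<exists>z0\<in>carrier_vec m. \<forall>u\<in>Uplus. \<forall>x. trajectory f x0 u x \<longrightarrow>
        (\<forall>t\<ge>0. norm (g (x t) (u t) - h (linear_state m A B z0 u t) (u t)) < \<epsilon>)"
      using output_approximation[OF _ assms(7) \<open>0 < \<epsilon>\<close>, of "{x0}", OF bounded_insert[THEN iffD2, OF bounded_empty]]
      by (elim exE conjE)
    obtain z0 where "z0 \<in> carrier_vec m" "\<forall>u\<in>Uplus. \<forall>x. trajectory f x0 u x \<longrightarrow>
        (\<forall>t\<ge>0. norm (g (x t) (u t) - h (linear_state m A B z0 u t) (u t)) < \<epsilon>)"
      using bspec[OF ex singletonI] by (elim bexE)
    with AB show "\<exists>m A B z0 h.
        A \<in> carrier_mat m m \<and> hurwitz A \<and> z0 \<in> carrier_vec m \<and> smooth_readout m h \<and>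
        (\<forall>u\<in>Uplus. \<forall>x. trajectory f x0 u x \<longrightarrow>
           (\<forall>t\<ge>0. norm (g (x t) (u t) - h (linear_state m A B z0 u t) (u t)) < \<epsilon>))"
      by (intro exI conjI)
  next
    fix \<epsilon> :: real assume "compact X0 \<and> realization_assumption U Y f g Uplus X0" "0 < \<epsilon>"
    \<comment> \<open>Compactness gives the boundedness under which one system and one readout serve
      all of \<open>X0\<close>, with only \<open>z0\<close> depending on the initial state.\<close>
    then have "bounded X0"
      by (simp add: compact_imp_bounded)
    then show "\<exists>m A B h.
        A \<in> carrier_mat m m \<and> hurwitz A \<and> smooth_readout m h \<and>
        (\<forall>x0\<in>X0. \<exists>z0\<in>carrier_vec m.
          \<forall>u\<in>Uplus. \<forall>x. trajectory f x0 u x \<longrightarrow>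
            (\<forall>t\<ge>0. norm (g (x t) (u t) - h (linear_state m A B z0 u t) (u t)) < \<epsilon>))"
      using assms(7) \<open>0 < \<epsilon>\<close> by (rule output_approximation)
  qed
qed

end
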